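(* Let $d\ge 2$ and $a>0$. Define $\lambda_a=\mu_d$ if $a\le a_c^+$ and $\lambda_a=e^{\mathcal{A}^+(a)}$ if $a>a_c^+$, and for $N\ge 1$ let \[ g_N(a,t)=\sum_{n=0}^N \frac{A_n^+(a)}{\lambda_a^n}\, t^n , \] a polynomial of degree $N$ in $t$ with zeros $t_1,\dots,t_N$ (counted with multiplicity). For $\rho\in(0,1)$ let $\nu_N(\rho)=\#\{k : 1-\rho\le |t_k|\le \frac{1}{1-\rho}\}$. Then the zeros of $g_N(a,t)$ converge on the unit circle $|t|=1$ as $N\to\infty$ in the sense that for any $\rho\in(0,1)$ and $\epsilon>0$ there is an $N_0$ such that for all $N\ge N_0$, $\left|1-\frac{1}{N}\nu_N(\rho)\right|<\epsilon$.
   Context: Let $\mathbb{L}^d$ be the $d$-dimensional hypercubic lattice and $\mathbb{L}^d_+$ the half-lattice consisting of vertices with last coordinate $\ge 0$ (and the lattice edges between them); its boundary $\partial\mathbb{L}^d_+$ is the set of vertices with last coordinate $0$. A positive walk is a self-avoiding walk in $\mathbb{L}^d_+$ starting at the origin; its visits are its vertices other than the origin lying in $\partial\mathbb{L}^d_+$. Let $c_n^+(v)$ be the number of positive walks of length $n$ with exactly $v$ visits, and $A_n^+(a)=\sum_{v=0}^n c_n^+(v)a^v$ (the partition function). $\mu_d$ is the growth constant of self-avoiding walks in $\mathbb{L}^d$. For $a>0$ the limit $\mathcal{A}^+(a)=\lim_{n\to\infty}\frac1n\log A_n^+(a)$ exists, and there is a critical value $a_c^+>1$ such that $\mathcal{A}^+(a)=\log\mu_d$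 for $a\le a_c^+$ and $\mathcal{A}^+(a)>\log\mu_d$ for $a>a_c^+$. In particular $A_n^+(a)=\lambda_a^{n+o(n)}$. *)

theory Defs
  imports Complex_Main "HOL-Computational_Algebra.Polynomial"
begin

text \<open>Vertices of the d-dimensional hypercubic lattice: integer lists of length d.
  The last coordinate is index d-1.\<close>

definition lat_adj :: "int list \<Rightarrow> int list \<Rightarrow> bool" where
  "lat_adj x y \<longleftrightarrow> length x = length y \<and> (\<Sum>i<length x. \<bar>x ! i - y ! i\<bar>) = 1"

definition saw :: "nat \<Rightarrow> nat \<Rightarrow> int list list \<Rightarrow> bool" where
  "saw d n w \<longleftrightarrow> length w = Suc n \<and> (\<forall>x\<in>set w. length x = d) \<and>
     w ! 0 = replicate d 0 \<and> (\<forall>i<n. lat_adj (w ! i) (w ! Suc i)) \<and> distinct w"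

definition pos_walk :: "nat \<Rightarrow> nat \<Rightarrow> int list list \<Rightarrow> bool" where
  "pos_walk d n w \<longleftrightarrow> saw d n w \<and> (\<forall>x\<in>set w. x ! (d - 1) \<ge> 0)"

definition visits :: "nat \<Rightarrow> int list list \<Rightarrow> nat" where
  "visits d w = card {i. 1 \<le> i \<and> i < length w \<and> (w ! i) ! (d - 1) = 0}"

definition c_saw :: "nat \<Rightarrow> nat \<Rightarrow> nat" where
  "c_saw d n = card {w. saw d n w}"

definition c_pos :: "nat \<Rightarrow> nat \<Rightarrow> nat \<Rightarrow> nat" where
  "c_pos d n v = card {w. pos_walk d n w \<and> visits d w = v}"

definition A_pos :: "nat \<Rightarrow> nat \<Rightarrow> real \<Rightarrow> real" where
  "A_pos d n a = (\<Sum>v\<le>n. real (c_pos d n v) * a ^ v)"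

definition mu :: "nat \<Rightarrow> real" where
  "mu d = lim (\<lambda>n. root n (real (c_saw d n)))"

definition free_energy :: "nat \<Rightarrow> real \<Rightarrow> real" where
  "free_energy d a = lim (\<lambda>n. ln (A_pos d n a) / real n)"

definition a_crit :: "nat \<Rightarrow> real" where
  "a_crit d = Sup {a. 0 < a \<and> free_energy d a = ln (mu d)}"

definition lambda_a :: "nat \<Rightarrow> real \<Rightarrow> real" where
  "lambda_a d a = (if a \<le> a_crit d then mu d else exp (free_energy d a))"

definition g_poly :: "nat \<Rightarrow> nat \<Rightarrow> real \<Rightarrow> complex poly" where
  "g_poly d N a = (\<Sum>n\<le>N. monom (complex_of_real (A_pos d n a / lambda_a d a ^ n)) n)"

definition nu :: "nat \<Rightarrow> nat \<Rightarrow> real \<Rightarrow> real \<Rightarrow> nat" where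
  "nu d N a \<rho> = (\<Sum>z\<in>{z. poly (g_poly d N a) z = 0 \<and> 1 - \<rho> \<le> cmod z \<and> cmod z \<le> 1 / (1 - \<rho>)}.
                    order z (g_poly d N a))"

end

theory Submission
  imports Defs "Berlekamp_Zassenhaus.Mahler_Measure" "HOL-Real_Asymp.Real_Asymp"
begin

text \<open>
  Landau's inequality bounds the Mahler measure of a polynomial by the sum of the moduli of its
  coefficients. If the coefficients are positive and of size \<open>exp (o(n))\<close>, it leaves only \<open>o(N)\<close>
  zeros inside \<open>|t| < r\<close> or outside \<open>|t| \<le> 1/r\<close>. So everything reduces to
  \<open>A_n(a) = \<lambda>_a ^ (n + o(n))\<close>.

  For this, Hammersley-Welsh unfolding in the first coordinate preserves heights, hence visits, and
  costs only a factor \<open>exp (o(n))\<close>. Two unfolded positive walks ending at the same height, the second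
  one reversed, are joined to a loop; unfolding loops at both ends gives a supermultiplicative
  sequence, so the free energy \<open>F\<close> exists by Fekete's lemma. Unfolding in the last coordinate gives
  \<open>F(1) = ln \<mu>\<close>. Monotonicity, \<open>F(a) \<ge> F(1)\<close>, \<open>F(a) \<ge> ln a\<close> and \<open>F(a) \<le> F(b) + ln (a/b)\<close> for \<open>b \<le> a\<close>
  then show that \<open>F = ln \<mu>\<close> up to and including the critical point.
\<close>

hide_const (open) up_ring.coeff module.smult up_ring.monom

section \<open>Unfolding integer sequences\<close>

text \<open>The weight \<open>a\<close> sits on the wall, so a translation or reflection that
  changes heights changes the weight of a walk. The moves behind the existence of the free energy
  therefore leave the last coordinate alone: folds and joining steps use direction 0, which differs
  from direction \<open>d - 1\<close> because \<open>d \<ge> 2\<close>. A positive walk may end at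
  any of n + 1 heights, and pieces can be joined only where their heights match. Squaring the
  contribution of one end height and reversing one of the two factors makes the heights match; the
  square root taken afterwards compensates for the doubled length.

  The constants \<open>mu\<close>, \<open>free_energy\<close> and \<open>a_crit\<close> are given by
  \<open>lim\<close> and \<open>Sup\<close>, which have a value even where nothing converges or the
  set is unbounded, so convergence and boundedness must be established before these definitions
  carry any meaning. Moreover \<open>lambda_a\<close> takes the value \<open>mu d\<close> at
  \<open>a_crit d\<close> itself, and a supremum need not be attained; hence the need for a
  continuity estimate in \<open>a\<close>.\<close>

definition refl_at :: "nat \<Rightarrow> (nat \<Rightarrow> int) \<Rightarrow> nat \<Rightarrow> int" where
  "refl_at s x i = (if i \<le> s then x i else 2 * x s - x i)"

lemma fold_refl_at_0 [simp]: "fold refl_at S x 0 = x 0"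
  by (induction S arbitrary: x) (simp_all add: refl_at_def)

lemma abs_diff_fold_refl_at:
  "\<bar>fold refl_at S x (Suc i) - fold refl_at S x i\<bar> = \<bar>x (Suc i) - x i\<bar>"
proof (induction S arbitrary: x)
  case (Cons s S)
  have "\<bar>refl_at s x (Suc i) - refl_at s x i\<bar> = \<bar>x (Suc i) - x i\<bar>"
    by (auto simp: refl_at_def not_less_eq_eq dest: le_antisym)
  with Cons show ?case by simp
qed simp

text \<open>A reflection fixes the value at its own time \<open>s\<close>, so the mirror level can
  be read off the image and the fold undone. The list of times alone, without the levels, thus
  determines the inverse.\<close>

lemma fold_refl_at_inject:
  assumes "set S \<subseteq> {..n}" "\<And>i. i \<le> n \<Longrightarrow> fold refl_at S x i = fold refl_at S y i" "i \<le> n"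
  shows "x i = y i"
  using assms
proof (induction S arbitrary: x y i)
  case (Cons s S)
  then have eq: "refl_at s x k = refl_at s y k" if "k \<le> n" for k
    using Cons.IH[of "refl_at s x" "refl_at s y" k] Cons.prems(1,2) that by simp
  from Cons.prems(1) have "s \<le> n" by simp
  from eq[OF this] have "x s = y s" by (simp add: refl_at_def)
  with eq[OF Cons.prems(3)] show ?case by (auto simp: refl_at_def split: if_splits)
qed simp

text \<open>With the last maximiser all later values are strictly smaller. After reflection they lie
  strictly above the level of \<open>m\<close>, so the two sides of the fold cannot collide.\<close>

lemma last_argmax:
  fixes x :: "nat \<Rightarrow> int"
  assumes "t \<le> n"
  obtains m where "t \<le> m" "m \<le> n" "\<And>i. t \<le> i \<Longrightarrow> i \<le> n \<Longrightarrow> x i \<le> x m"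
    "\<And>i. m < i \<Longrightarrow> i \<le> n \<Longrightarrow> x i < x m"
proof -
  define M where "M = Max (x ` {t..n})"
  define m where "m = Max {i \<in> {t..n}. x i = M}"
  have M: "x i \<le> M" if "t \<le> i" "i \<le> n" for i using that by (simp add: M_def)
  have "M \<in> x ` {t..n}" unfolding M_def using assms by (intro Max_in) auto
  then have ne: "{i \<in> {t..n}. x i = M} \<noteq> {}" by auto
  have m: "m \<in> {i \<in> {t..n}. x i = M}" unfolding m_def using ne by (intro Max_in) auto
  have le: "i \<le> m" if "t \<le> i" "i \<le> n" "x i = M" for i using that by (simp add: m_def)
  have "x i < x m" if "m < i" "i \<le> n" for i
  proof -
    from m have "t \<le> m" "x m = M" by auto
    with that le[of i] M[of i] show ?thesis by fastforce
  qed
  with m M show ?thesis by (intro that[of m]) auto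
qed

lemma diff_le_of_unit_steps:
  fixes x :: "nat \<Rightarrow> int"
  assumes "\<And>i. i < n \<Longrightarrow> \<bar>x (Suc i) - x i\<bar> \<le> 1" "s \<le> t" "t \<le> n"
  shows "x t - x s \<le> int (t - s)"
  using assms(2,3)
proof (induction t rule: dec_induct)
  case (step t)
  with assms(1)[of t] show ?case by (auto simp: of_nat_diff)
qed simp

text \<open>Reflecting the part after the last maximum yields a new last part of strictly smaller span.
  The spans of the successive parts are distinct and add up to at most \<open>n - t\<close>, so only
  \<open>O(sqrt n)\<close> reflections are needed.\<close>

lemma unfold_forward:
  assumes "\<And>i. i < n \<Longrightarrow> \<bar>x (Suc i) - x i\<bar> \<le> 1" "t \<le> n"
    "\<And>i. i \<le> t \<Longrightarrow> x i \<le> x t" "\<And>i. t < i \<Longrightarrow> i \<le> n \<Longrightarrow> x t < x i"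
  shows "\<exists>S. set S \<subseteq> {..n} \<and> (\<exists>k\<in>{t..n}. int (length S) \<le> x k - x t)
    \<and> length S * (length S + 1) \<le> 2 * (n - t)
    \<and> (\<forall>i\<le>t. fold refl_at S x i = x i)
    \<and> (\<forall>i. t < i \<and> i \<le> n \<longrightarrow> x t < fold refl_at S x i)
    \<and> (\<forall>i\<le>n. fold refl_at S x i \<le> fold refl_at S x n)
    \<and> (\<forall>i\<le>n. \<forall>k\<le>n. fold refl_at S x i = fold refl_at S x k \<longrightarrow> x i = x k)"
  using assms
proof (induction "n - t" arbitrary: x t rule: less_induct)
  case less
  obtain m where m: "t \<le> m" "m \<le> n" "\<And>i. t \<le> i \<Longrightarrow> i \<le> n \<Longrightarrow> x i \<le> x m"
    "\<And>i. m < i \<Longrightarrow> i \<le> n \<Longrightarrow> x i < x m"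
    using last_argmax[OF less.prems(2)] by blast
  have le_m: "x i \<le> x m" if "i \<le> n" for i
    using that m(3)[of i] less.prems(3)[of i] m(3)[of t] less.prems(2) by linarith
  show ?case
  proof (cases "m = n")
    case True
    with le_m less.prems(2,4) show ?thesis by (intro exI[of _ "[]"]) (auto intro!: bexI[of _ t])
  next
    case False
    with m have "m < n" by simp
    have "t < m"
      using m(1) m(4)[of n] less.prems(4)[of n] \<open>m < n\<close> by (cases "t = m") auto
    define y where "y = refl_at m x"
    have y_low: "y i = x i" if "i \<le> m" for i using that by (simp add: y_def refl_at_def)
    have y_high: "y i = 2 * x m - x i" if "m < i" for i using that by (simp add: y_def refl_at_def)
    have "\<exists>S. set S \<subseteq> {..n} \<and> (\<exists>k\<in>{m..n}. int (length S) \<le> y k - y m)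
      \<and> length S * (length S + 1) \<le> 2 * (n - m)
      \<and> (\<forall>i\<le>m. fold refl_at S y i = y i)
      \<and> (\<forall>i. m < i \<and> i \<le> n \<longrightarrow> y m < fold refl_at S y i)
      \<and> (\<forall>i\<le>n. fold refl_at S y i \<le> fold refl_at S y n)
      \<and> (\<forall>i\<le>n. \<forall>k\<le>n. fold refl_at S y i = fold refl_at S y k \<longrightarrow> y i = y k)"
    proof (rule less.hyps)
      show "n - m < n - t" using \<open>t < m\<close> \<open>m < n\<close> by simp
      show "\<bar>y (Suc i) - y i\<bar> \<le> 1" if "i < n" for i
        using abs_diff_fold_refl_at[of "[m]" x i] less.prems(1)[OF that] by (simp add: y_def)
      show "y i \<le> y m" if "i \<le> m" for i using that m(2) le_m by (simp add: y_low)
      show "y m < y i" if "m < i" "i \<le> n" for i using that m(4) by (simp add: y_low y_high)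
    qed (use m in auto)
    then obtain S k where S: "set S \<subseteq> {..n}" "k \<in> {m..n}" "int (length S) \<le> y k - y m"
      "length S * (length S + 1) \<le> 2 * (n - m)"
      "\<And>i. i \<le> m \<Longrightarrow> fold refl_at S y i = y i"
      "\<And>i. m < i \<Longrightarrow> i \<le> n \<Longrightarrow> y m < fold refl_at S y i"
      "\<And>i. i \<le> n \<Longrightarrow> fold refl_at S y i \<le> fold refl_at S y n"
      "\<And>i k. i \<le> n \<Longrightarrow> k \<le> n \<Longrightarrow> fold refl_at S y i = fold refl_at S y k \<Longrightarrow> y i = y k"
      by blast
    \<comment> \<open>The reflected tail spans \<open>y k - y m = x m - x k\<close>, and
      \<open>x k\<close> is strictly above \<open>x t\<close>; over the integers this strictness
      pays for the one additional fold.\<close>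
    have len: "int (length S) + 1 \<le> x m - x t"
    proof (cases "k = m")
      case True
      with S(3) less.prems(4)[of m] \<open>t < m\<close> m(2) show ?thesis by simp
    next
      case False
      with S(2,3) less.prems(4)[of k] \<open>t < m\<close> show ?thesis by (simp add: y_low y_high)
    qed
    \<comment> \<open>Unit steps turn the span into time: \<open>m - t\<close> is at least
      \<open>length S + 1\<close>, and twice this is exactly the growth of l(l + 1) when l goes from
      \<open>length S\<close> to \<open>length S + 1\<close>.\<close>
    have "x m - x t \<le> int (m - t)"
      using less.prems(1) m(1,2) by (intro diff_le_of_unit_steps) auto
    with len have "length S + 1 \<le> m - t" by linarith
    then have len2: "(length S + 1) * (length S + 2) \<le> 2 * (n - t)"
      using S(4) \<open>t < m\<close> \<open>m < n\<close> by (simp add: algebra_simps)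
    \<comment> \<open>Values of \<open>y\<close> up to time \<open>m\<close> are at most
      \<open>x m\<close>, later ones exceed it, so equal values of \<open>y\<close> come from the
      same side of the fold.\<close>
    have inj: "x i = x k" if "i \<le> n" "k \<le> n" "y i = y k" for i k
    proof -
      have "y i < y k" if "i \<le> m" "m < k" "k \<le> n" for i k
        using that le_m[of i] m(4)[of k] m(2) by (simp add: y_low y_high)
      from this[of i k] this[of k i] that show ?thesis
        by (cases "i \<le> m"; cases "k \<le> m") (auto simp: y_low y_high)
    qed
    have above: "x t < fold refl_at S y i" if "t < i" "i \<le> n" for i
    proof (cases "i \<le> m")
      case True
      with that S(5) less.prems(4) show ?thesis by (simp add: y_low)
    next
      case False
      with that S(6)[of i] m(3)[of t] \<open>t < m\<close> \<open>m < n\<close> show ?thesis by (simp add: y_low)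
    qed
    show ?thesis
    proof (intro exI[of _ "m # S"] conjI)
      show "\<exists>k\<in>{t..n}. int (length (m # S)) \<le> x k - x t"
        using len m(1,2) by (intro bexI[of _ m]) auto
      show "set (m # S) \<subseteq> {..n}" using S(1) m(2) by simp
      show "length (m # S) * (length (m # S) + 1) \<le> 2 * (n - t)" using len2 by simp
      show "\<forall>i\<le>t. fold refl_at (m # S) x i = x i"
        using S(5) \<open>t < m\<close> by (simp flip: y_def add: y_low)
      show "\<forall>i. t < i \<and> i \<le> n \<longrightarrow> x t < fold refl_at (m # S) x i"
        using above by (simp flip: y_def)
      show "\<forall>i\<le>n. fold refl_at (m # S) x i \<le> fold refl_at (m # S) x n"
        using S(7) by (simp flip: y_def)
      show "\<forall>i\<le>n. \<forall>k\<le>n. fold refl_at (m # S) x i = fold refl_at (m # S) x k \<longrightarrow> x i = x k"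
      proof (intro allI impI)
        fix i k assume ik: "i \<le> n" "k \<le> n" and "fold refl_at (m # S) x i = fold refl_at (m # S) x k"
        then have "fold refl_at S y i = fold refl_at S y k" by (simp add: y_def)
        from inj[OF ik S(8)[OF ik this]] show "x i = x k" .
      qed
    qed
  qed
qed

text \<open>The factor \<open>length S - 1\<close> allows for the initial fold put in front of the
  list from \<open>unfold_forward\<close>, whose length l satisfies l(l + 1) \<le> 2n.\<close>

definition fold_seqs :: "nat \<Rightarrow> nat list set" where
  "fold_seqs n = {S. set S \<subseteq> {..n} \<and> length S * (length S - 1) \<le> 2 * n}"

text \<open>Folding at the last global maximum first creates the situation that
  \<open>unfold_forward\<close> starts from. The third conclusion says that folding never merges
  different values, which is what keeps an unfolded walk self-avoiding; the fourth lets a walk that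
  starts at its minimum keep doing so.\<close>

lemma unfold_max_at_end:
  assumes "\<And>i. i < n \<Longrightarrow> \<bar>x (Suc i) - x i\<bar> \<le> 1"
  obtains S where "S \<in> fold_seqs n"
    "\<And>i. i \<le> n \<Longrightarrow> fold refl_at S x i \<le> fold refl_at S x n"
    "\<And>i k. i \<le> n \<Longrightarrow> k \<le> n \<Longrightarrow> fold refl_at S x i = fold refl_at S x k \<Longrightarrow> x i = x k"
    "\<And>i. \<forall>k\<le>n. x 0 \<le> x k \<Longrightarrow> i \<le> n \<Longrightarrow> x 0 \<le> fold refl_at S x i"
proof -
  obtain m where m: "m \<le> n" "\<And>i. i \<le> n \<Longrightarrow> x i \<le> x m" "\<And>i. m < i \<Longrightarrow> i \<le> n \<Longrightarrow> x i < x m"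
    using last_argmax[of 0 n x] by auto
  define y where "y = refl_at m x"
  have y_low: "y i = x i" if "i \<le> m" for i using that by (simp add: y_def refl_at_def)
  have y_high: "y i = 2 * x m - x i" if "m < i" for i using that by (simp add: y_def refl_at_def)
  have "\<exists>S. set S \<subseteq> {..n} \<and> (\<exists>k\<in>{m..n}. int (length S) \<le> y k - y m)
    \<and> length S * (length S + 1) \<le> 2 * (n - m)
    \<and> (\<forall>i\<le>m. fold refl_at S y i = y i)
    \<and> (\<forall>i. m < i \<and> i \<le> n \<longrightarrow> y m < fold refl_at S y i)
    \<and> (\<forall>i\<le>n. fold refl_at S y i \<le> fold refl_at S y n)
    \<and> (\<forall>i\<le>n. \<forall>k\<le>n. fold refl_at S y i = fold refl_at S y k \<longrightarrow> y i = y k)"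
  proof (rule unfold_forward)
    show "\<bar>y (Suc i) - y i\<bar> \<le> 1" if "i < n" for i
      using abs_diff_fold_refl_at[of "[m]" x i] assms(1)[OF that] by (simp add: y_def)
    show "y i \<le> y m" if "i \<le> m" for i using that m(1,2) by (simp add: y_low)
    show "y m < y i" if "m < i" "i \<le> n" for i using that m(3) by (simp add: y_low y_high)
  qed (use m in auto)
  then obtain S where S: "set S \<subseteq> {..n}" "length S * (length S + 1) \<le> 2 * (n - m)"
    "\<And>i. i \<le> m \<Longrightarrow> fold refl_at S y i = y i"
    "\<And>i. m < i \<Longrightarrow> i \<le> n \<Longrightarrow> y m < fold refl_at S y i"
    "\<And>i. i \<le> n \<Longrightarrow> fold refl_at S y i \<le> fold refl_at S y n"
    "\<And>i k. i \<le> n \<Longrightarrow> k \<le> n \<Longrightarrow> fold refl_at S y i = fold refl_at S y k \<Longrightarrow> y i = y k"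
    by blast
  have inj: "x i = x k" if "i \<le> n" "k \<le> n" "y i = y k" for i k
  proof -
    have "y i < y k" if "i \<le> m" "m < k" "k \<le> n" for i k
      using that m(1) m(2)[of i] m(3)[of k] by (simp add: y_low y_high)
    from this[of i k] this[of k i] that show ?thesis
      by (cases "i \<le> m"; cases "k \<le> m") (auto simp: y_low y_high)
  qed
  show ?thesis
  proof (rule that[of "m # S"])
    have "length (m # S) * (length (m # S) - 1) \<le> 2 * n" using S(2) by (simp add: algebra_simps)
    with S(1) m(1) show "m # S \<in> fold_seqs n" by (auto simp: fold_seqs_def)
    show "x 0 \<le> fold refl_at (m # S) x i" if "\<forall>k\<le>n. x 0 \<le> x k" "i \<le> n" for i
    proof -
      from that m(1) have "x 0 \<le> x i" "x 0 \<le> x m" by auto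
      with S(3)[of i] S(4)[of i] that(2) show ?thesis
        by (cases "i \<le> m") (auto simp: y_low simp flip: y_def)
    qed
    show "fold refl_at (m # S) x i \<le> fold refl_at (m # S) x n" if "i \<le> n" for i
      using S(5) that by (simp flip: y_def)
    show "x i = x k" if "i \<le> n" "k \<le> n" "fold refl_at (m # S) x i = fold refl_at (m # S) x k" for i k
      using inj[OF that(1,2) S(6)[OF that(1,2)]] that(3) by (simp flip: y_def)
  qed
qed

text \<open>Since l(l - 1) \<le> 2n forces l \<le> sqrt(2n) + 1, there are only exp(O(sqrt n log n))
  fold lists, a factor that disappears after taking logarithms and dividing by n.\<close>

lemma finite_fold_seqs: "finite (fold_seqs n)" (is ?A)
  and card_fold_seqs_le: "real (card (fold_seqs n)) \<le> (real n + 2) powr (sqrt (2 * real n) + 1)" (is ?B)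
proof -
  define K where "K = nat \<lfloor>sqrt (2 * real n)\<rfloor> + 1"
  have K: "real K \<le> sqrt (2 * real n) + 1"
    by (simp add: K_def) 
  have "length S \<le> K" if "length S * (length S - 1) \<le> 2 * n" for S :: "nat list"
  proof (cases "length S")
    case (Suc m)
    then have "m * m \<le> 2 * n" using that by simp
    then have "(real m)\<^sup>2 \<le> 2 * real n"
      unfolding power2_eq_square by (metis of_nat_le_iff of_nat_mult of_nat_numeral)
    then have "real m \<le> sqrt (2 * real n)" by (rule real_le_rsqrt)
    then have "int m \<le> \<lfloor>sqrt (2 * real n)\<rfloor>" by (simp add: le_floor_iff)
    with Suc show ?thesis by (simp add: K_def)
  qed simp
  then have sub: "fold_seqs n \<subseteq> {S. set S \<subseteq> {..n} \<and> length S \<le> K}"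
    by (auto simp: fold_seqs_def)
  have fin: "finite {S. set S \<subseteq> {..n} \<and> length S \<le> K}"
    by (intro finite_lists_length_le) simp
  from finite_subset[OF sub fin] show ?A .
  \<comment> \<open>Passing from base n + 1 to n + 2 absorbs the sum over all lengths.\<close>
  have pow: "(\<Sum>i\<le>k. Suc n ^ i) \<le> (n + 2) ^ k" for k
  proof (induction k)
    case (Suc k)
    have "Suc n ^ Suc k = Suc n * Suc n ^ k" by simp
    also have "\<dots> \<le> Suc n * (n + 2) ^ k" by (intro mult_left_mono power_mono) auto
    finally show ?case using Suc by simp
  qed simp
  have "card (fold_seqs n) \<le> card {S. set S \<subseteq> {..n} \<and> length S \<le> K}"
    using sub fin by (rule card_mono[rotated])
  also have "\<dots> = (\<Sum>i\<le>K. Suc n ^ i)" by (subst card_lists_length_le) auto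
  also have "\<dots> \<le> (n + 2) ^ K" by (rule pow)
  finally have "real (card (fold_seqs n)) \<le> real ((n + 2) ^ K)" by linarith
  also have "\<dots> = (real n + 2) powr real K" by (simp add: powr_realpow add.commute)
  also have "\<dots> \<le> (real n + 2) powr (sqrt (2 * real n) + 1)"
    using K by (intro powr_mono) auto
  finally show ?B .
qed

section \<open>Lattice walks and their unfolding\<close>

text \<open>The starting point is left free so that reversed, reflected and translated pieces remain
  in the class.\<close>

definition lat_walk :: "nat \<Rightarrow> nat \<Rightarrow> int list list \<Rightarrow> bool" where
  "lat_walk d n w \<longleftrightarrow> length w = Suc n \<and> (\<forall>x\<in>set w. length x = d) \<and>
     (\<forall>i<n. lat_adj (w ! i) (w ! Suc i)) \<and> distinct w"

lemma saw_iff: "saw d n w \<longleftrightarrow> lat_walk d n w \<and> w ! 0 = replicate d 0"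
  by (auto simp: saw_def lat_walk_def)

lemma lat_walk_length: "lat_walk d n w \<Longrightarrow> length w = Suc n"
  by (simp add: lat_walk_def)

lemma lat_walk_vertex_length: "lat_walk d n w \<Longrightarrow> i \<le> n \<Longrightarrow> length (w ! i) = d"
  by (simp add: lat_walk_def)

lemma lat_walk_last: "lat_walk d n w \<Longrightarrow> last w = w ! n"
  by (cases w rule: rev_cases) (auto simp: lat_walk_def nth_append)

lemma lat_walk_set_conv: "lat_walk d n w \<Longrightarrow> set w = (!) w ` {..n}"
  by (auto simp: lat_walk_def set_conv_nth less_Suc_eq_le)

lemma lat_walk_coord_step:
  assumes "lat_walk d n w" "j < d" "i < n"
  shows "\<bar>w ! Suc i ! j - w ! i ! j\<bar> \<le> 1"
proof -
  have "length (w ! i) = d" using assms by (intro lat_walk_vertex_length) auto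
  then have "(\<Sum>k<d. \<bar>w ! i ! k - w ! Suc i ! k\<bar>) = 1"
    using assms by (auto simp: lat_walk_def lat_adj_def)
  moreover have "\<bar>w ! i ! j - w ! Suc i ! j\<bar> \<le> (\<Sum>k<d. \<bar>w ! i ! k - w ! Suc i ! k\<bar>)"
    using assms(2) by (intro member_le_sum) auto
  ultimately show ?thesis by linarith
qed

lemma lat_adj_sym: "lat_adj x y \<longleftrightarrow> lat_adj y x"
  by (auto simp: lat_adj_def abs_minus_commute)

lemma lat_adj_isometry:
  assumes "lat_adj x y" "length x = d" "length x' = d" "length y' = d"
    "\<And>k. k < d \<Longrightarrow> \<bar>x' ! k - y' ! k\<bar> = \<bar>x ! k - y ! k\<bar>"
  shows "lat_adj x' y'"
  using assms by (auto simp: lat_adj_def)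

lemma lat_walk_rev:
  assumes "lat_walk d n w"
  shows "lat_walk d n (rev w)"
proof -
  have "lat_adj (rev w ! i) (rev w ! Suc i)" if "i < n" for i
  proof -
    have "lat_adj (w ! (n - Suc i)) (w ! Suc (n - Suc i))"
      using assms that by (auto simp: lat_walk_def)
    moreover have "Suc (n - Suc i) = n - i" using that by simp
    ultimately show ?thesis
      using that assms by (simp add: rev_nth lat_walk_length lat_adj_sym)
  qed
  with assms show ?thesis by (simp add: lat_walk_def)
qed

text \<open>Adjacency and distinctness of vertices are both visible in coordinatewise distances, so
  translations and reflections of single coordinates are covered at once.\<close>

lemma lat_walk_map_isometry:
  assumes w: "lat_walk d n w" and len: "\<And>v. length (T v) = d"
    and iso: "\<And>x y k. k < d \<Longrightarrow> \<bar>T x ! k - T y ! k\<bar> = \<bar>x ! k - y ! k\<bar>"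
  shows "lat_walk d n (map T w)"
proof -
  have "inj_on T (set w)"
  proof
    fix x y assume xy: "x \<in> set w" "y \<in> set w" "T x = T y"
    show "x = y"
    proof (rule nth_equalityI)
      show "length x = length y" using w xy by (simp add: lat_walk_def)
      show "x ! k = y ! k" if "k < length x" for k
        using iso[of k x y] w xy that by (simp add: lat_walk_def)
    qed
  qed
  moreover have "lat_adj (map T w ! i) (map T w ! Suc i)" if "i < n" for i
  proof (rule lat_adj_isometry)
    show "lat_adj (w ! i) (w ! Suc i)" "length (w ! i) = d" using w that by (auto simp: lat_walk_def)
  qed (use w that len iso in \<open>auto simp: lat_walk_length\<close>)
  ultimately show ?thesis
    using w len by (auto simp: lat_walk_def distinct_map)
qed

text \<open>The joining edge is itself a step, whence the extra 1 that later shifts the index in the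
  supermultiplicative inequality.\<close>

lemma lat_walk_append:
  assumes "lat_walk d n w" "lat_walk d m u" "lat_adj (w ! n) (u ! 0)" "set w \<inter> set u = {}"
  shows "lat_walk d (n + m + 1) (w @ u)"
proof -
  have "lat_adj ((w @ u) ! i) ((w @ u) ! Suc i)" if "i < n + m + 1" for i
  proof -
    consider "i < n" | "i = n" | "n < i" by linarith
    then show ?thesis
    proof cases
      case 3
      then have "i - Suc n < m" "Suc (i - Suc n) = Suc i - Suc n" using that by auto
      then have "lat_adj (u ! (i - Suc n)) (u ! (Suc i - Suc n))"
        using assms(2) unfolding lat_walk_def by metis
      with 3 show ?thesis using assms(1) by (simp add: nth_append lat_walk_length)
    qed (use assms in \<open>auto simp: lat_walk_def nth_append\<close>)
  qed
  with assms show ?thesis by (auto simp: lat_walk_def)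
qed

text \<open>Unlike \<^const>\<open>visits\<close>, this counts the initial vertex, so it is additive under concatenation
  and invariant under reversal.\<close>

definition wall_contacts :: "nat \<Rightarrow> int list list \<Rightarrow> nat" where
  "wall_contacts d w = length (filter (\<lambda>v. v ! (d - 1) = 0) w)"

lemma wall_contacts_append: "wall_contacts d (w @ u) = wall_contacts d w + wall_contacts d u"
  by (simp add: wall_contacts_def)

lemma wall_contacts_rev: "wall_contacts d (rev w) = wall_contacts d w"
  by (simp add: wall_contacts_def flip: rev_filter)

lemma wall_contacts_cong:
  assumes "length w = length u" "\<And>i. i < length w \<Longrightarrow> w ! i ! (d - 1) = u ! i ! (d - 1)"
  shows "wall_contacts d w = wall_contacts d u"
  unfolding wall_contacts_def length_filter_conv_card using assms by (intro arg_cong[of _ _ card]) auto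

lemma wall_contacts_eq_Suc_visits:
  assumes "w \<noteq> []" "w ! 0 ! (d - 1) = 0"
  shows "wall_contacts d w = Suc (visits d w)"
proof -
  let ?V = "{i. 1 \<le> i \<and> i < length w \<and> w ! i ! (d - 1) = 0}"
  have "wall_contacts d w = card {i. i < length w \<and> w ! i ! (d - 1) = 0}"
    by (simp add: wall_contacts_def length_filter_conv_card)
  also have "{i. i < length w \<and> w ! i ! (d - 1) = 0} = insert 0 ?V"
    using assms by (auto simp: Suc_le_eq)
  also have "card (insert 0 ?V) = Suc (card ?V)"
    by (rule card_insert_disjoint) auto
  finally show ?thesis by (simp add: visits_def)
qed

text \<open>Every step vector has entries in {-1, 0, 1}. This crude count is enough for the linear
  upper bound that Fekete's lemma asks for.\<close>

lemma finite_lat_walks_from: "finite {w. lat_walk d n w \<and> w ! 0 = v}"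
  and card_lat_walks_from_le: "card {w. lat_walk d n w \<and> w ! 0 = v} \<le> (3 ^ d) ^ n"
proof -
  let ?W = "\<lambda>n. {w. lat_walk d n w \<and> w ! 0 = v}"
  let ?D = "{s :: int list. set s \<subseteq> {-1, 0, 1} \<and> length s = d}"
  have finD: "finite ?D" by (intro finite_lists_length_eq) simp
  have cardD: "card ?D = 3 ^ d" by (subst card_lists_length_eq) (auto simp: numeral_3_eq_3)
  have "finite (?W n) \<and> card (?W n) \<le> (3 ^ d) ^ n"
  proof (induction n)
    case 0
    have "?W 0 \<subseteq> {[v]}" by (auto simp: lat_walk_def length_Suc_conv)
    then show ?case using card_mono[of "{[v]}" "?W 0"] finite_subset by auto
  next
    case (Suc n)
    let ?f = "\<lambda>(w, s). w @ [map2 (+) (last w) s]"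
    have sub: "?W (Suc n) \<subseteq> ?f ` (?W n \<times> ?D)"
    proof
      fix w assume "w \<in> ?W (Suc n)"
      then have w: "lat_walk d (Suc n) w" "w ! 0 = v" by auto
      define u where "u = butlast w"
      define s where "s = map2 (-) (w ! Suc n) (w ! n)"
      have "w \<noteq> []" using w(1) by (auto simp: lat_walk_def)
      then have u: "w = u @ [w ! Suc n]" "length u = Suc n"
        using w(1) append_butlast_last_id[of w] lat_walk_last[OF w(1)] by (auto simp: u_def lat_walk_length)
      have nth_u: "u ! i = w ! i" if "i \<le> n" for i using u that by (metis less_Suc_eq_le nth_append)
      have "lat_walk d n u"
        unfolding lat_walk_def
      proof (intro conjI)
        show "distinct u" "\<forall>x\<in>set u. length x = d"
          using w(1) u(1) unfolding lat_walk_def by (metis distinct_append, metis Un_iff set_append)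
        show "\<forall>i<n. lat_adj (u ! i) (u ! Suc i)" using w(1) nth_u by (simp add: lat_walk_def)
      qed (rule u(2))
      moreover have "u ! 0 = v" using nth_u w(2) by simp
      moreover have "last u = w ! n" using nth_u[of n] u(2) by (metis diff_Suc_1 last_conv_nth length_0_conv nat.distinct(1) order_refl)
      moreover have len: "length (w ! Suc n) = d" "length (w ! n) = d" using lat_walk_vertex_length[OF w(1)] by auto
      then have "map2 (+) (w ! n) s = w ! Suc n"
        by (intro nth_equalityI) (auto simp: s_def)
      moreover have "s \<in> ?D"
      proof -
        have "s ! j \<in> {-1, 0, 1}" if "j < d" for j
          using lat_walk_coord_step[OF w(1) that, of n] that len by (auto simp: s_def)
        moreover have "length s = d" using len by (simp add: s_def)
        ultimately show ?thesis unfolding set_conv_nth by blast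
      qed
      ultimately show "w \<in> ?f ` (?W n \<times> ?D)"
        using u(1) by (intro image_eqI[of _ _ "(u, s)"]) auto
    qed
    have fin: "finite (?W n \<times> ?D)" using Suc finD by auto
    have "card (?W (Suc n)) \<le> card (?f ` (?W n \<times> ?D))"
      using sub fin by (intro card_mono) auto
    also have "\<dots> \<le> card (?W n \<times> ?D)" using fin by (rule card_image_le)
    also have "\<dots> = card (?W n) * 3 ^ d" using cardD by (simp add: card_cartesian_product)
    also have "\<dots> \<le> (3 ^ d) ^ Suc n" using Suc by (simp add: mult.commute)
    finally show ?case using finite_subset[OF sub] fin by blast
  qed
  then show "finite (?W n)" "card (?W n) \<le> (3 ^ d) ^ n" by auto
qed

section \<open>Folding one coordinate of a walk\<close>

definition unfold_coord :: "nat \<Rightarrow> nat list \<Rightarrow> int list list \<Rightarrow> int list list" where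
  "unfold_coord j S w = map (\<lambda>i. (w ! i)[j := fold refl_at S (\<lambda>i. w ! i ! j) i]) [0..<length w]"

lemma length_unfold_coord [simp]: "length (unfold_coord j S w) = length w"
  by (simp add: unfold_coord_def)

lemma nth_unfold_coord: "i < length w \<Longrightarrow> unfold_coord j S w ! i = (w ! i)[j := fold refl_at S (\<lambda>i. w ! i ! j) i]"
  by (simp add: unfold_coord_def)

lemma nth_unfold_coord_same:
  "lat_walk d n w \<Longrightarrow> j < d \<Longrightarrow> i \<le> n \<Longrightarrow> unfold_coord j S w ! i ! j = fold refl_at S (\<lambda>i. w ! i ! j) i"
  by (simp add: nth_unfold_coord lat_walk_length lat_walk_vertex_length)

lemma nth_unfold_coord_other:
  "lat_walk d n w \<Longrightarrow> k \<noteq> j \<Longrightarrow> i \<le> n \<Longrightarrow> unfold_coord j S w ! i ! k = w ! i ! k"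
  by (simp add: nth_unfold_coord lat_walk_length)

lemma unfold_coord_start: "lat_walk d n w \<Longrightarrow> unfold_coord j S w ! 0 = w ! 0"
  by (simp add: nth_unfold_coord lat_walk_length)

text \<open>Coordinate \<open>j\<close> is recovered by undoing the folds in \<open>S\<close>, and
  the others are never touched. Injectivity holds for each fixed \<open>S\<close>; different fold
  lists may share images, which is why their number enters the later estimates.\<close>

lemma inj_on_unfold_coord:
  assumes S: "S \<in> fold_seqs n" and j: "j < d"
  shows "inj_on (unfold_coord j S) {w. lat_walk d n w}"
proof (rule inj_onI, clarsimp)
  fix w u assume w: "lat_walk d n w" and u: "lat_walk d n u" and eq: "unfold_coord j S w = unfold_coord j S u"
  show "w = u"
  proof (rule nth_equalityI)
    fix i assume "i < length w"
    then have i: "i \<le> n" using w by (simp add: lat_walk_length)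
    show "w ! i = u ! i"
    proof (rule nth_equalityI)
      fix k assume "k < length (w ! i)"
      then have k: "k < d" using lat_walk_vertex_length[OF w i] by simp
      show "w ! i ! k = u ! i ! k"
      proof (cases "k = j")
        case True
        have "fold refl_at S (\<lambda>i. w ! i ! j) i = fold refl_at S (\<lambda>i. u ! i ! j) i" if "i \<le> n" for i
          using nth_unfold_coord_same[OF w j that, of S] nth_unfold_coord_same[OF u j that, of S] eq by simp
        from fold_refl_at_inject[OF _ this i] S True show ?thesis by (simp add: fold_seqs_def)
      next
        case False
        from nth_unfold_coord_other[OF w this i, of S] nth_unfold_coord_other[OF u this i, of S] eq show ?thesis by simp
      qed
    qed (use lat_walk_vertex_length[OF w i] lat_walk_vertex_length[OF u i] in simp)
  qed (use w u in \<open>simp add: lat_walk_length\<close>)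
qed

lemma unfold_walk:
  assumes w: "lat_walk d n w" and j: "j < d"
  obtains S where "S \<in> fold_seqs n" "lat_walk d n (unfold_coord j S w)"
    "\<And>i. i \<le> n \<Longrightarrow> unfold_coord j S w ! i ! j \<le> unfold_coord j S w ! n ! j"
    "\<And>i. \<forall>k\<le>n. w ! 0 ! j \<le> w ! k ! j \<Longrightarrow> i \<le> n \<Longrightarrow> w ! 0 ! j \<le> unfold_coord j S w ! i ! j"
proof -
  let ?x = "\<lambda>i. w ! i ! j"
  obtain S where S: "S \<in> fold_seqs n"
    "\<And>i. i \<le> n \<Longrightarrow> fold refl_at S ?x i \<le> fold refl_at S ?x n"
    "\<And>i k. i \<le> n \<Longrightarrow> k \<le> n \<Longrightarrow> fold refl_at S ?x i = fold refl_at S ?x k \<Longrightarrow> ?x i = ?x k"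
    "\<And>i. \<forall>k\<le>n. ?x 0 \<le> ?x k \<Longrightarrow> i \<le> n \<Longrightarrow> ?x 0 \<le> fold refl_at S ?x i"
    using unfold_max_at_end[of n ?x] lat_walk_coord_step[OF w j] by blast
  have "lat_walk d n (unfold_coord j S w)"
    unfolding lat_walk_def
  proof (intro conjI allI impI ballI)
    show "length (unfold_coord j S w) = Suc n" using w by (simp add: lat_walk_length)
    show "length x = d" if "x \<in> set (unfold_coord j S w)" for x
      using that w by (auto simp: unfold_coord_def lat_walk_def)
    show "lat_adj (unfold_coord j S w ! i) (unfold_coord j S w ! Suc i)" if "i < n" for i
    proof (rule lat_adj_isometry)
      show "lat_adj (w ! i) (w ! Suc i)" "length (w ! i) = d" using w that by (auto simp: lat_walk_def)
      show "length (unfold_coord j S w ! i) = d" "length (unfold_coord j S w ! Suc i) = d"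
        using that w by (auto simp: nth_unfold_coord lat_walk_length lat_walk_vertex_length)
      show "\<bar>unfold_coord j S w ! i ! k - unfold_coord j S w ! Suc i ! k\<bar> = \<bar>w ! i ! k - w ! Suc i ! k\<bar>" if "k < d" for k
        using that \<open>i < n\<close> abs_diff_fold_refl_at[of S ?x i] j w
        by (cases "k = j") (auto simp: nth_unfold_coord_same nth_unfold_coord_other abs_minus_commute)
    qed
    \<comment> \<open>A collision of unfolded vertices forces one of the original vertices: in
      coordinate \<open>j\<close> because folding merges no values, elsewhere because nothing
      changes.\<close>
    have "i = k" if "i \<le> n" "k \<le> n" "unfold_coord j S w ! i = unfold_coord j S w ! k" for i k
    proof -
      have "w ! i ! l = w ! k ! l" if "l < d" for l
      proof (cases "l = j")
        case True
        then show ?thesis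
          using S(3)[OF \<open>i \<le> n\<close> \<open>k \<le> n\<close>] \<open>unfold_coord j S w ! i = unfold_coord j S w ! k\<close>
            nth_unfold_coord_same[OF w j \<open>i \<le> n\<close>, of S] nth_unfold_coord_same[OF w j \<open>k \<le> n\<close>, of S] by simp
      next
        case False
        then show ?thesis
          using \<open>unfold_coord j S w ! i = unfold_coord j S w ! k\<close>
            nth_unfold_coord_other[OF w False \<open>i \<le> n\<close>, of S] nth_unfold_coord_other[OF w False \<open>k \<le> n\<close>, of S] by simp
      qed
      then have "w ! i = w ! k"
        using that lat_walk_vertex_length[OF w] by (intro nth_equalityI) auto
      then show ?thesis using w that by (simp add: lat_walk_def nth_eq_iff_index_eq)
    qed
    then show "distinct (unfold_coord j S w)" using w by (auto simp: distinct_conv_nth lat_walk_length less_Suc_eq_le)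
  qed
  then show ?thesis
  proof (rule that[OF S(1)])
    show "unfold_coord j S w ! i ! j \<le> unfold_coord j S w ! n ! j" if "i \<le> n" for i
      using S(2)[OF that] that by (simp add: nth_unfold_coord_same[OF w j])
    show "w ! 0 ! j \<le> unfold_coord j S w ! i ! j" if "\<forall>k\<le>n. w ! 0 ! j \<le> w ! k ! j" "i \<le> n" for i
      using S(4) that by (simp add: nth_unfold_coord_same[OF w j])
  qed
qed

text \<open>Choose any suitable \<open>S\<close> for each \<open>w\<close>. The pair of
  \<open>S\<close> and \<open>\<phi> S w\<close> determines \<open>w\<close>, so \<open>P\<close>
  embeds into \<open>T \<times> Q\<close>; no canonical choice is involved.\<close>

lemma sum_le_card_mult_sum:
  fixes f :: "'a \<Rightarrow> real"
  assumes fin: "finite T" "finite Q" and inj: "\<And>S. S \<in> T \<Longrightarrow> inj_on (\<phi> S) P"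
    and ex: "\<And>w. w \<in> P \<Longrightarrow> \<exists>S\<in>T. \<phi> S w \<in> Q \<and> f w = g (\<phi> S w)"
    and nonneg: "\<And>w. w \<in> Q \<Longrightarrow> g w \<ge> 0"
  shows "sum f P \<le> real (card T) * sum g Q"
proof -
  obtain \<sigma> where \<sigma>: "\<And>w. w \<in> P \<Longrightarrow> \<sigma> w \<in> T \<and> \<phi> (\<sigma> w) w \<in> Q \<and> f w = g (\<phi> (\<sigma> w) w)"
    using bchoice[of P "\<lambda>w S. S \<in> T \<and> \<phi> S w \<in> Q \<and> f w = g (\<phi> S w)"] ex by blast
  define h where "h w = (\<sigma> w, \<phi> (\<sigma> w) w)" for w
  have injh: "inj_on h P"
  proof (rule inj_onI)
    fix w u assume wu: "w \<in> P" "u \<in> P" "h w = h u"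
    then have "\<phi> (\<sigma> w) w = \<phi> (\<sigma> w) u" by (auto simp: h_def)
    from inj_onD[OF inj this] \<sigma> wu(1,2) show "w = u" by blast
  qed
  have sub: "h ` P \<subseteq> T \<times> Q" using \<sigma> by (auto simp: h_def)
  have "sum f P = (\<Sum>w\<in>P. g (snd (h w)))" using \<sigma> by (intro sum.cong) (auto simp: h_def)
  also have "\<dots> = (\<Sum>p\<in>h ` P. g (snd p))" by (simp add: sum.reindex[OF injh])
  also have "\<dots> \<le> (\<Sum>p\<in>T \<times> Q. g (snd p))"
    using sub fin nonneg by (intro sum_mono2) auto
  also have "\<dots> = real (card T) * sum g Q"
    by (simp add: sum.cartesian_product')
  finally show ?thesis .
qed

section \<open>Half-space walks weighted by wall contacts\<close>

text \<open>Horizontal coordinates are normalised to start at 0, but the height is absolute because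
  contacts depend on it. Starting heights other than 0 arise by reversal.\<close>

definition hs_walks :: "nat \<Rightarrow> nat \<Rightarrow> int \<Rightarrow> int \<Rightarrow> int list list set" where
  "hs_walks d n h k = {w. lat_walk d n w \<and> w ! 0 = (replicate d 0)[d - 1 := h] \<and>
     w ! n ! (d - 1) = k \<and> (\<forall>v\<in>set w. 0 \<le> v ! (d - 1))}"

text \<open>The non-strict inequality is enough here and in \<open>min_start\<close>, because
  \<open>glue\<close> inserts a step that separates the two pieces in direction 0.\<close>

definition max_end :: "int list list \<Rightarrow> bool" where
  "max_end w \<longleftrightarrow> (\<forall>v\<in>set w. v ! 0 \<le> last w ! 0)"

definition min_start :: "int list list \<Rightarrow> bool" where
  "min_start w \<longleftrightarrow> (\<forall>v\<in>set w. w ! 0 ! 0 \<le> v ! 0)"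

definition contact_sum :: "nat \<Rightarrow> real \<Rightarrow> int list list set \<Rightarrow> real" where
  "contact_sum d a P = (\<Sum>w\<in>P. a ^ wall_contacts d w)"

text \<open>The sign change compensates for the reversal: a walk ending at its maximum in direction
  0 becomes one starting at its minimum. The height keeps its sign so that contacts survive.\<close>

definition reverse_walk :: "nat \<Rightarrow> int list list \<Rightarrow> int list list" where
  "reverse_walk d w =
     map (\<lambda>v. map (\<lambda>k. if k = d - 1 then v ! k else last w ! k - v ! k) [0..<d]) (rev w)"

text \<open>The two walks are joined by a step in direction 0. The height of the second walk is not
  shifted: it is meant to start at the height where the first one ends.\<close>

definition glue :: "nat \<Rightarrow> int list list \<Rightarrow> int list list \<Rightarrow> int list list" where
  "glue d w u = w @ map (\<lambda>v. map (\<lambda>k. if k = d - 1 then v ! k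
     else last w ! k + v ! k + (if k = 0 then 1 else 0)) [0..<d]) u"

lemma finite_hs_walks: "finite (hs_walks d n h k)"
  by (rule finite_subset[OF _ finite_lat_walks_from[of d n "(replicate d 0)[d - 1 := h]"]])
    (auto simp: hs_walks_def)

lemma contact_sum_mono: "P \<subseteq> Q \<Longrightarrow> finite Q \<Longrightarrow> a > 0 \<Longrightarrow> contact_sum d a P \<le> contact_sum d a Q"
  unfolding contact_sum_def by (intro sum_mono2) auto

lemma contact_sum_nonneg: "a > 0 \<Longrightarrow> 0 \<le> contact_sum d a P"
  unfolding contact_sum_def by (intro sum_nonneg) auto

lemma contact_sum_inj_le:
  assumes "inj_on f P" "f ` P \<subseteq> Q" "\<And>w. w \<in> P \<Longrightarrow> wall_contacts d (f w) = wall_contacts d w" "finite Q" "a > 0"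
  shows "contact_sum d a P \<le> contact_sum d a Q"
proof -
  have "contact_sum d a P = contact_sum d a (f ` P)"
    unfolding contact_sum_def using assms(1,3) by (simp add: sum.reindex)
  also have "\<dots> \<le> contact_sum d a Q" using assms by (intro contact_sum_mono)
  finally show ?thesis .
qed

lemma contact_sum_prod_le:
  assumes "inj_on (\<lambda>(w, u). f w u) (P \<times> Q)" "\<And>w u. w \<in> P \<Longrightarrow> u \<in> Q \<Longrightarrow> f w u \<in> R"
    "\<And>w u. w \<in> P \<Longrightarrow> u \<in> Q \<Longrightarrow> wall_contacts d (f w u) = wall_contacts d w + wall_contacts d u" "finite R" "a > 0"
  shows "contact_sum d a P * contact_sum d a Q \<le> contact_sum d a R"
proof -
  have "contact_sum d a P * contact_sum d a Q = (\<Sum>(w, u)\<in>P \<times> Q. a ^ wall_contacts d w * a ^ wall_contacts d u)"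
    unfolding contact_sum_def by (simp add: sum_product sum.cartesian_product)
  also have "\<dots> = (\<Sum>p\<in>P \<times> Q. a ^ wall_contacts d ((\<lambda>(w, u). f w u) p))"
    using assms(3) by (intro sum.cong) (auto simp: power_add)
  also have "\<dots> = contact_sum d a ((\<lambda>(w, u). f w u) ` (P \<times> Q))"
    unfolding contact_sum_def by (simp only: sum.reindex[OF assms(1)] o_def)
  also have "\<dots> \<le> contact_sum d a R"
    using assms by (intro contact_sum_mono) auto
  finally show ?thesis .
qed

lemma hs_walksD:
  assumes "w \<in> hs_walks d n h k"
  shows "lat_walk d n w" "w ! 0 = (replicate d 0)[d - 1 := h]" "last w ! (d - 1) = k"
    "v \<in> set w \<Longrightarrow> 0 \<le> v ! (d - 1)" "w \<noteq> []" "v \<in> set w \<Longrightarrow> length v = d"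
  using assms lat_walk_last[of d n w] by (auto simp: hs_walks_def lat_walk_def)

context
  fixes d :: nat
  assumes d2: "2 \<le> d"
begin

lemma start_coord:
  assumes "w \<in> hs_walks d n h k" "j < d"
  shows "hd w ! j = (if j = d - 1 then h else 0)" "w ! 0 ! j = (if j = d - 1 then h else 0)"
  using hs_walksD(2,5)[OF assms(1)] assms(2) by (auto simp: hd_conv_nth nth_list_update)

section \<open>Reversal of half-space walks\<close>

lemma reverse_walk_in_hs_walks:
  assumes w: "w \<in> hs_walks d n h k"
  shows "reverse_walk d w \<in> hs_walks d n k h"
proof -
  note D = hs_walksD[OF w]
  define T where "T v = map (\<lambda>k. if k = d - 1 then v ! k else last w ! k - v ! k) [0..<d]" for v
  have T: "reverse_walk d w = map T (rev w)" by (simp add: reverse_walk_def T_def)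
  have len: "length (T v) = d" for v by (simp add: T_def)
  have wn: "length w = Suc n" using D(1) by (rule lat_walk_length)
  have "lat_walk d n (map T (rev w))"
    using lat_walk_rev[OF D(1)] len by (rule lat_walk_map_isometry) (auto simp: T_def)
  moreover have "map T (rev w) ! 0 = T (last w)"
    using D(5) wn by (simp add: rev_nth last_conv_nth)
  moreover have "T (last w) = (replicate d 0)[d - 1 := k]"
    by (rule nth_equalityI) (use D(3) in \<open>auto simp: T_def nth_list_update\<close>)
  moreover have "map T (rev w) ! n = T (w ! 0)"
    using wn by (simp add: rev_nth)
  moreover have "T (w ! 0) ! (d - 1) = h"
    using d2 start_coord[OF w, of "d - 1"] by (simp add: T_def)
  moreover have "0 \<le> v ! (d - 1)" if "v \<in> set (map T (rev w))" for v
    using that D(4) d2 by (auto simp: T_def)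
  ultimately show ?thesis by (simp add: hs_walks_def T)
qed

lemma reverse_walk_min_start:
  assumes w: "w \<in> hs_walks d n h k" "max_end w"
  shows "min_start (reverse_walk d w)"
proof -
  have "reverse_walk d w ! 0 = (replicate d 0)[d - 1 := k]"
    using reverse_walk_in_hs_walks[OF w(1)] by (rule hs_walksD)
  then have "reverse_walk d w ! 0 ! 0 = 0" using d2 by simp
  moreover have "0 \<le> v ! 0" if "v \<in> set (reverse_walk d w)" for v
    using that w(2) d2 by (auto simp: reverse_walk_def max_end_def)
  ultimately show ?thesis by (simp add: min_start_def)
qed

lemma wall_contacts_reverse_walk: "wall_contacts d (reverse_walk d w) = wall_contacts d w"
proof -
  have "wall_contacts d (reverse_walk d w) = wall_contacts d (rev w)"
    using d2 by (intro wall_contacts_cong) (auto simp: reverse_walk_def)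
  then show ?thesis by (simp add: wall_contacts_rev)
qed

lemma reverse_walk_involutive:
  assumes w: "w \<in> hs_walks d n h k"
  shows "reverse_walk d (reverse_walk d w) = w"
proof -
  note D = hs_walksD[OF w]
  \<comment> \<open>The reversed walk ends at \<open>last w - hd w\<close>, and \<open>hd w\<close>
    vanishes in horizontal directions; so the second reversal reflects about the same centre as the
    first.\<close>
  have last: "last (reverse_walk d w) ! j = last w ! j" if "j < d" "j \<noteq> d - 1" for j
    using that start_coord[OF w] D(5) by (simp add: reverse_walk_def last_map last_rev)
  show ?thesis
  proof (rule nth_equalityI)
    fix i assume "i < length (reverse_walk d (reverse_walk d w))"
    then have i: "i < length w" by (simp add: reverse_walk_def)
    then have len: "length (w ! i) = d" using D(6) by simp
    show "reverse_walk d (reverse_walk d w) ! i = w ! i"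
    proof (rule nth_equalityI)
      fix j assume "j < length (reverse_walk d (reverse_walk d w) ! i)"
      then have "j < d" using i by (simp add: reverse_walk_def)
      with i last[of j] show "reverse_walk d (reverse_walk d w) ! i ! j = w ! i ! j"
        by (simp add: reverse_walk_def[of d "reverse_walk d w"])
          (simp add: reverse_walk_def rev_map rev_nth)
    qed (use i len in \<open>simp add: reverse_walk_def\<close>)
  qed (simp add: reverse_walk_def)
qed

lemma contact_sum_reverse_le:
  assumes "a > 0"
  shows "contact_sum d a {w \<in> hs_walks d n h k. max_end w} \<le> contact_sum d a {w \<in> hs_walks d n k h. min_start w}"
proof (rule contact_sum_inj_le[where f = "reverse_walk d"])
  show "inj_on (reverse_walk d) {w \<in> hs_walks d n h k. max_end w}"
    by (rule inj_on_inverseI[where g = "reverse_walk d"]) (auto intro: reverse_walk_involutive)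
qed (use assms in \<open>auto simp: wall_contacts_reverse_walk reverse_walk_in_hs_walks reverse_walk_min_start finite_hs_walks\<close>)

section \<open>Concatenation of half-space walks and supermultiplicativity\<close>

lemma glue_walks:
  assumes w: "w \<in> hs_walks d n h k" "max_end w" and u: "u \<in> hs_walks d m k l" "min_start u"
  shows "glue d w u \<in> hs_walks d (n + m + 1) h l"
    and "min_start w \<Longrightarrow> min_start (glue d w u)"
    and "max_end u \<Longrightarrow> max_end (glue d w u)"
    and "wall_contacts d (glue d w u) = wall_contacts d w + wall_contacts d u"
proof -
  note W = hs_walksD[OF w(1)] and U = hs_walksD[OF u(1)]
  define T where "T v = map (\<lambda>k. if k = d - 1 then v ! k
     else last w ! k + v ! k + (if k = 0 then 1 else 0)) [0..<d]" for v
  have glue: "glue d w u = w @ map T u" by (simp add: glue_def T_def)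
  have len: "length (T v) = d" for v by (simp add: T_def)
  have T0: "T v ! 0 = last w ! 0 + v ! 0 + 1" for v using d2 by (simp add: T_def)
  have Td: "T v ! (d - 1) = v ! (d - 1)" for v using d2 by (simp add: T_def)
  have u0: "u ! 0 ! 0 = 0" using start_coord(2)[OF u(1), of 0] d2 by simp
  have upos: "0 \<le> v ! 0" if "v \<in> set u" for v using u(2) u0 that by (auto simp: min_start_def)
  have lwn: "length w = Suc n" "length u = Suc m" using W(1) U(1) by (auto intro: lat_walk_length)
  have last: "last (glue d w u) = T (last u)" using U(5) by (simp add: glue last_map)
  have start: "glue d w u ! 0 = w ! 0" using lwn by (simp add: glue nth_append)
  have "lat_walk d (n + m + 1) (w @ map T u)"
  proof (rule lat_walk_append[OF W(1)])
    show "lat_walk d m (map T u)" using U(1) len by (rule lat_walk_map_isometry) (auto simp: T_def)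
    have wn: "length (w ! n) = d" "w ! n = last w"
      using W(1) by (auto simp: lat_walk_vertex_length lat_walk_last)
    \<comment> \<open>The heights cancel because \<open>u\<close> starts at the height
      \<open>k\<close> where \<open>w\<close> ends; only the inserted unit in direction 0
      remains.\<close>
    have "\<bar>w ! n ! j - T (u ! 0) ! j\<bar> = (if j = 0 then 1 else 0)" if "j < d" for j
      using that start_coord(2)[OF u(1), of j] W(3) d2 by (auto simp: T_def wn)
    then have "(\<Sum>j<d. \<bar>w ! n ! j - T (u ! 0) ! j\<bar>) = (\<Sum>j<d. if j = 0 then 1 else 0)"
      by (intro sum.cong) auto
    also have "\<dots> = 1" using d2 by (simp add: sum.delta)
    finally show "lat_adj (w ! n) (map T u ! 0)"
      using lwn by (simp add: lat_adj_def wn(1) len)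
    \<comment> \<open>In direction 0 the first piece stays at or below the level of its end and the
      translated second piece at least one above it.\<close>
    have "v \<noteq> T v'" if "v \<in> set w" "v' \<in> set u" for v v'
      using that w(2) upos[OF that(2)] T0[of v'] unfolding max_end_def by fastforce
    then show "set w \<inter> set (map T u) = {}" by auto
  qed
  moreover have "0 \<le> v ! (d - 1)" if "v \<in> set (w @ map T u)" for v
    using that W(4) U(4) Td by auto
  moreover have "(w @ map T u) ! (n + m + 1) ! (d - 1) = l"
    using U(3) lat_walk_last[OF U(1)] lwn by (simp add: nth_append Td[simplified])
  ultimately show "glue d w u \<in> hs_walks d (n + m + 1) h l"
    using W(2) start by (simp add: hs_walks_def glue)
  have w0: "w ! 0 ! 0 \<le> last w ! 0" using w(2) W(5) by (simp add: max_end_def)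
  have lastu: "last u \<in> set u" using U(5) by simp
  show "min_start (glue d w u)" if "min_start w"
    unfolding min_start_def start
  proof
    fix v assume "v \<in> set (glue d w u)"
    then consider "v \<in> set w" | v' where "v' \<in> set u" "v = T v'" by (auto simp: glue)
    then show "w ! 0 ! 0 \<le> v ! 0"
      using that w0 upos by cases (force simp: min_start_def T0)+
  qed
  show "max_end (glue d w u)" if "max_end u"
    unfolding max_end_def last
  proof
    fix v assume "v \<in> set (glue d w u)"
    then consider "v \<in> set w" | v' where "v' \<in> set u" "v = T v'" by (auto simp: glue)
    then show "v ! 0 \<le> T (last u) ! 0"
      using that w(2) upos[OF lastu] by cases (force simp: max_end_def T0)+
  qed
  have "wall_contacts d (map T u) = wall_contacts d u" by (intro wall_contacts_cong) (simp_all add: Td[simplified])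
  then show "wall_contacts d (glue d w u) = wall_contacts d w + wall_contacts d u" by (simp add: glue wall_contacts_append)
qed

text \<open>The cut is known because all first factors have n + 1 vertices. Once the first factor is
  recovered, so is the translation applied to the second.\<close>

lemma inj_on_glue: "inj_on (\<lambda>(w, u). glue d w u) (hs_walks d n h k \<times> hs_walks d m k l)"
proof (rule inj_onI, clarsimp)
  fix w u w' u'
  assume in_hs: "w \<in> hs_walks d n h k" "u \<in> hs_walks d m k l" "w' \<in> hs_walks d n h k" "u' \<in> hs_walks d m k l"
    and eq: "glue d w u = glue d w' u'"
  define T where "T v = map (\<lambda>k. if k = d - 1 then v ! k
     else last w ! k + v ! k + (if k = 0 then 1 else 0)) [0..<d]" for v
  have "length w = length w'"
    using in_hs(1,3) by (metis hs_walksD(1) lat_walk_length)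
  with eq have w: "w = w'" by (simp add: glue_def)
  have T: "glue d w v = w @ map T v" for v by (simp add: glue_def T_def[abs_def])
  from eq[folded w] have "map T u = map T u'" by (simp add: T)
  note w this
  moreover have "inj_on T (set u \<union> set u')"
  proof (rule inj_onI)
    fix x y assume "x \<in> set u \<union> set u'" "y \<in> set u \<union> set u'" and eq: "T x = T y"
    then have len: "length x = d" "length y = d" using in_hs(2,4) by (auto dest: hs_walksD(6))
    show "x = y"
    proof (rule nth_equalityI)
      fix j assume "j < length x"
      with len have "j < d" by simp
      moreover from eq have "T x ! j = T y ! j" by simp
      ultimately show "x ! j = y ! j" by (auto simp: T_def split: if_splits)
    qed (simp add: len)
  qed
  ultimately show "w = w' \<and> u = u'" by (simp add: inj_on_map_eq_map)
qed

lemma contact_sum_glue_le: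
  assumes "a > 0"
  shows "contact_sum d a {w \<in> hs_walks d n h k. max_end w} * contact_sum d a {w \<in> hs_walks d m k l. min_start w}
    \<le> contact_sum d a (hs_walks d (n + m + 1) h l)"
proof (rule contact_sum_prod_le[where f = "glue d"])
  show "inj_on (\<lambda>(w, u). glue d w u)
    ({w \<in> hs_walks d n h k. max_end w} \<times> {w \<in> hs_walks d m k l. min_start w})"
    by (rule inj_on_subset[OF inj_on_glue]) auto
qed (use assms glue_walks in \<open>auto simp: finite_hs_walks\<close>)

text \<open>Bridges in direction 0 with both ends on the wall. Unlike general positive walks, any
  two of them can be joined without further conditions.\<close>

definition bridge_loops :: "nat \<Rightarrow> int list list set" where
  "bridge_loops n = {w \<in> hs_walks d n 0 0. min_start w \<and> max_end w}"

lemma finite_bridge_loops: "finite (bridge_loops n)"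
  by (simp add: bridge_loops_def finite_hs_walks)

lemma contact_sum_bridge_loops_supermult:
  assumes "a > 0"
  shows "contact_sum d a (bridge_loops n) * contact_sum d a (bridge_loops m) \<le> contact_sum d a (bridge_loops (n + m + 1))"
proof (rule contact_sum_prod_le[where f = "glue d"])
  show "inj_on (\<lambda>(w, u). glue d w u) (bridge_loops n \<times> bridge_loops m)"
    by (rule inj_on_subset[OF inj_on_glue]) (auto simp: bridge_loops_def)
qed (use assms glue_walks in \<open>auto simp: bridge_loops_def finite_hs_walks\<close>)

section \<open>Unfolding half-space walks into bridge loops\<close>

lemma unfold_coord_in_hs_walks:
  assumes "w \<in> hs_walks d n h k" "lat_walk d n (unfold_coord 0 S w)"
  shows "unfold_coord 0 S w \<in> hs_walks d n h k" "wall_contacts d (unfold_coord 0 S w) = wall_contacts d w"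
proof -
  note D = hs_walksD[OF assms(1)]
  \<comment> \<open>Direction 0 and direction \<open>d - 1\<close> are distinct since
    \<open>d \<ge> 2\<close>.\<close>
  have height: "unfold_coord 0 S w ! i ! (d - 1) = w ! i ! (d - 1)" if "i \<le> n" for i
    using D(1) d2 that by (intro nth_unfold_coord_other) auto
  then show "wall_contacts d (unfold_coord 0 S w) = wall_contacts d w"
    using lat_walk_length[OF D(1)] by (intro wall_contacts_cong) auto
  have "0 \<le> v ! (d - 1)" if "v \<in> set (unfold_coord 0 S w)" for v
    using that D(4) lat_walk_length[OF D(1)] height
    by (auto simp: lat_walk_set_conv[OF assms(2)])
  with assms height show "unfold_coord 0 S w \<in> hs_walks d n h k"
    by (simp add: hs_walks_def unfold_coord_start[OF D(1)])
qed

text \<open>The second estimate follows since folding preserves a minimum at the start. It allows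
  both ends to be treated in turn without the second unfolding spoiling what the first one
  achieved.\<close>

lemma contact_sum_unfold_le:
  assumes "a > 0"
  shows "contact_sum d a (hs_walks d n h k)
           \<le> real (card (fold_seqs n)) * contact_sum d a {w \<in> hs_walks d n h k. max_end w}" (is ?A)
    and "contact_sum d a {w \<in> hs_walks d n h k. min_start w}
           \<le> real (card (fold_seqs n)) * contact_sum d a {w \<in> hs_walks d n h k. min_start w \<and> max_end w}" (is ?B)
proof -
  have inj: "inj_on (unfold_coord 0 S) P" if "S \<in> fold_seqs n" "P \<subseteq> hs_walks d n h k" for S P
    using inj_on_subset[OF inj_on_unfold_coord[OF that(1), of 0 d]] that(2) d2 by (auto simp: hs_walks_def)
  have ex: "\<exists>S\<in>fold_seqs n. unfold_coord 0 S w \<in> hs_walks d n h k \<and> max_end (unfold_coord 0 S w)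
      \<and> (min_start w \<longrightarrow> min_start (unfold_coord 0 S w)) \<and> a ^ wall_contacts d w = a ^ wall_contacts d (unfold_coord 0 S w)"
    if w: "w \<in> hs_walks d n h k" for w
  proof -
    note lw = hs_walksD(1)[OF w]
    obtain S where S: "S \<in> fold_seqs n" "lat_walk d n (unfold_coord 0 S w)"
      "\<And>i. i \<le> n \<Longrightarrow> unfold_coord 0 S w ! i ! 0 \<le> unfold_coord 0 S w ! n ! 0"
      "\<And>i. \<forall>k\<le>n. w ! 0 ! 0 \<le> w ! k ! 0 \<Longrightarrow> i \<le> n \<Longrightarrow> w ! 0 ! 0 \<le> unfold_coord 0 S w ! i ! 0"
      using unfold_walk[OF lw, of 0] d2 by auto
    have "max_end (unfold_coord 0 S w)"
      using S(3) by (auto simp: max_end_def lat_walk_last[OF S(2)] lat_walk_set_conv[OF S(2)])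
    moreover have "min_start (unfold_coord 0 S w)" if "min_start w"
      using that S(4) by (auto simp: min_start_def unfold_coord_start[OF lw] lat_walk_set_conv[OF S(2)] lat_walk_set_conv[OF lw])
    ultimately show ?thesis using S(1) unfold_coord_in_hs_walks[OF w S(2)] by auto
  qed
  show ?A unfolding contact_sum_def
  proof (rule sum_le_card_mult_sum[where \<phi> = "unfold_coord 0"])
    show "\<exists>S\<in>fold_seqs n. unfold_coord 0 S w \<in> {w \<in> hs_walks d n h k. max_end w} \<and> a ^ wall_contacts d w = a ^ wall_contacts d (unfold_coord 0 S w)"
      if "w \<in> hs_walks d n h k" for w using ex[OF that] by blast
  qed (use assms inj in \<open>auto simp: finite_fold_seqs finite_hs_walks\<close>)
  show ?B unfolding contact_sum_def
  proof (rule sum_le_card_mult_sum[where \<phi> = "unfold_coord 0"])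
    show "\<exists>S\<in>fold_seqs n. unfold_coord 0 S w \<in> {w \<in> hs_walks d n h k. min_start w \<and> max_end w}
        \<and> a ^ wall_contacts d w = a ^ wall_contacts d (unfold_coord 0 S w)"
      if "w \<in> {w \<in> hs_walks d n h k. min_start w}" for w using ex[of w] that by blast
  qed (use assms inj in \<open>auto simp: finite_fold_seqs finite_hs_walks\<close>)
qed

text \<open>One factor climbs from the wall to height \<open>k\<close>, the other, reversed, returns
  to the wall. The two lengths and the joining step add up to \<open>2 * n + 1\<close>.\<close>

lemma contact_sum_hs_walks_square_le:
  assumes a: "a > 0"
  shows "(contact_sum d a (hs_walks d n 0 k))\<^sup>2 \<le> (real (card (fold_seqs n)))\<^sup>2
    * ((real (card (fold_seqs (2 * n + 1))))\<^sup>2 * contact_sum d a (bridge_loops (2 * n + 1)))"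
proof -
  let ?M = "contact_sum d a {w \<in> hs_walks d n 0 k. max_end w}"
  let ?L = "contact_sum d a (hs_walks d (2 * n + 1) 0 0)"
  let ?T = "real (card (fold_seqs (2 * n + 1)))"
  have "?M\<^sup>2 \<le> ?M * contact_sum d a {w \<in> hs_walks d n k 0. min_start w}"
    unfolding power2_eq_square using contact_sum_reverse_le[OF a] contact_sum_nonneg[OF a] by (intro mult_left_mono)
  also have "\<dots> \<le> ?L"
    using contact_sum_glue_le[OF a, of n 0 k n 0] by (simp add: mult_2)
  also have "?L \<le> ?T * contact_sum d a {w \<in> hs_walks d (2 * n + 1) 0 0. max_end w}"
    by (rule contact_sum_unfold_le(1)[OF a])
  \<comment> \<open>Reversal moves the extremal end to the start, leaving the other end free for the
    second unfolding; both ends are on the wall, so the class of heights is unchanged.\<close>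
  also have "\<dots> \<le> ?T * contact_sum d a {w \<in> hs_walks d (2 * n + 1) 0 0. min_start w}"
    by (intro mult_left_mono contact_sum_reverse_le[OF a]) auto
  also have "\<dots> \<le> ?T * (?T * contact_sum d a (bridge_loops (2 * n + 1)))"
    unfolding bridge_loops_def by (intro mult_left_mono contact_sum_unfold_le(2)[OF a]) auto
  finally have M: "?M\<^sup>2 \<le> ?T\<^sup>2 * contact_sum d a (bridge_loops (2 * n + 1))"
    by (simp add: power2_eq_square mult.assoc)
  have "(contact_sum d a (hs_walks d n 0 k))\<^sup>2 \<le> (real (card (fold_seqs n)) * ?M)\<^sup>2"
    using contact_sum_unfold_le(1)[OF a] contact_sum_nonneg[OF a] by (intro power_mono) auto
  also have "\<dots> = (real (card (fold_seqs n)))\<^sup>2 * ?M\<^sup>2" by (simp add: power_mult_distrib)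
  also have "\<dots> \<le> (real (card (fold_seqs n)))\<^sup>2 * (?T\<^sup>2 * contact_sum d a (bridge_loops (2 * n + 1)))"
    using M by (intro mult_left_mono) auto
  finally show ?thesis .
qed

end

section \<open>Partition functions\<close>

lemma pos_walk_start_height: "2 \<le> d \<Longrightarrow> pos_walk d n w \<Longrightarrow> w \<noteq> [] \<and> w ! 0 ! (d - 1) = 0"
  by (auto simp: pos_walk_def saw_def)

lemma replicate_update_same: "(replicate d x)[i := x] = replicate d x"
  using list_update_id[of "replicate d x" i] by (cases "i < d") (auto simp: list_update_beyond)

lemma finite_saws: "finite {w. saw d n w}"
  using finite_lat_walks_from[of d n "replicate d 0"] by (simp add: saw_iff)

lemma finite_pos_walks: "finite {w. pos_walk d n w}"
  by (rule finite_subset[OF _ finite_saws]) (auto simp: pos_walk_def)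

lemma visits_le: "pos_walk d n w \<Longrightarrow> visits d w \<le> n"
proof -
  assume "pos_walk d n w"
  then have "{i. 1 \<le> i \<and> i < length w \<and> w ! i ! (d - 1) = 0} \<subseteq> {1..n}"
    by (auto simp: pos_walk_def saw_def)
  from card_mono[OF _ this] show ?thesis by (simp add: visits_def)
qed

lemma A_pos_eq_sum: "A_pos d n a = (\<Sum>w | pos_walk d n w. a ^ visits d w)"
proof -
  have "(\<Sum>w | pos_walk d n w. a ^ visits d w)
    = (\<Sum>v\<le>n. \<Sum>w\<in>{w \<in> {w. pos_walk d n w}. visits d w = v}. a ^ visits d w)"
    by (rule sum.group[symmetric]) (auto simp: finite_pos_walks visits_le)
  also have "\<dots> = A_pos d n a"
    unfolding A_pos_def c_pos_def by (intro sum.cong) auto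
  finally show ?thesis by simp
qed

lemma A_pos_1: "A_pos d n 1 = real (card {w. pos_walk d n w})"
  by (simp add: A_pos_eq_sum)

lemma A_pos_mono: "0 < a \<Longrightarrow> a \<le> b \<Longrightarrow> A_pos d n a \<le> A_pos d n b"
  unfolding A_pos_eq_sum by (intro sum_mono power_mono) auto

text \<open>A walk of n steps has at most n visits, so replacing \<open>b\<close> by
  \<open>a\<close> costs at most one factor \<open>a / b\<close> per step. In the limit this makes
  the free energy Lipschitz in ln a.\<close>

lemma A_pos_le_scaled:
  assumes "0 < b" "b \<le> a"
  shows "A_pos d n a \<le> (a / b) ^ n * A_pos d n b"
proof -
  have "a ^ visits d w \<le> (a / b) ^ n * b ^ visits d w" if "pos_walk d n w" for w
  proof -
    have "a ^ visits d w = (a / b) ^ visits d w * b ^ visits d w"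
      using assms by (simp flip: power_mult_distrib)
    also have "\<dots> \<le> (a / b) ^ n * b ^ visits d w"
      using assms visits_le[OF that] by (intro mult_right_mono power_increasing) auto
    finally show ?thesis .
  qed
  then show ?thesis unfolding A_pos_eq_sum sum_distrib_left by (intro sum_mono) auto
qed

lemma A_pos_1_le_c_saw: "A_pos d n 1 \<le> real (c_saw d n)"
  unfolding A_pos_1 c_saw_def of_nat_le_iff
  by (intro card_mono finite_saws) (auto simp: pos_walk_def)

context
  fixes d :: nat
  assumes d2: "2 \<le> d"
begin

text \<open>Height changes by at most 1 per step, so only n + 1 end heights occur; this polynomial
  factor is harmless.\<close>

lemma pos_walks_eq_UN_hs_walks: "{w. pos_walk d n w} = (\<Union>k\<le>n. hs_walks d n 0 (int k))"
proof (intro equalityI subsetI)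
  fix w assume "w \<in> {w. pos_walk d n w}"
  then have w: "lat_walk d n w" "w ! 0 = replicate d 0" "\<forall>v\<in>set w. 0 \<le> v ! (d - 1)"
    by (auto simp: pos_walk_def saw_iff)
  have "w ! n ! (d - 1) - w ! 0 ! (d - 1) \<le> int (n - 0)"
    using lat_walk_coord_step[OF w(1)] d2 by (intro diff_le_of_unit_steps[of n]) auto
  moreover have "0 \<le> w ! n ! (d - 1)" using w(1,3) by (simp add: lat_walk_length)
  ultimately have "w \<in> hs_walks d n 0 (int (nat (w ! n ! (d - 1))))" "nat (w ! n ! (d - 1)) \<le> n"
    using w d2 by (auto simp: hs_walks_def replicate_update_same)
  then show "w \<in> (\<Union>k\<le>n. hs_walks d n 0 (int k))" by blast
next
  fix w assume "w \<in> (\<Union>k\<le>n. hs_walks d n 0 (int k))"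
  then show "w \<in> {w. pos_walk d n w}"
    using d2 by (auto simp: hs_walks_def pos_walk_def saw_iff replicate_update_same)
qed

text \<open>The extra factor \<open>a\<close> is the contact at the origin, which
  \<open>visits\<close> leaves out.\<close>

lemma contact_sum_pos_walks: "contact_sum d a {w. pos_walk d n w} = a * A_pos d n a"
  unfolding contact_sum_def A_pos_eq_sum sum_distrib_left
  using pos_walk_start_height[OF d2] by (intro sum.cong) (auto simp: wall_contacts_eq_Suc_visits)

lemma contact_sum_bridge_loops_le:
  assumes "a > 0"
  shows "contact_sum d a (bridge_loops d n) \<le> a * A_pos d n a"
proof -
  have "hs_walks d n 0 0 \<subseteq> {w. pos_walk d n w}"
    unfolding pos_walks_eq_UN_hs_walks by force
  then have "bridge_loops d n \<subseteq> {w. pos_walk d n w}"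
    by (auto simp: bridge_loops_def[OF d2])
  from contact_sum_mono[OF this finite_pos_walks assms, of d] show ?thesis by (simp add: contact_sum_pos_walks)
qed

text \<open>Take square roots in the squared estimate for each end height and sum over the n + 1
  heights.\<close>

lemma A_pos_le_bridge_loops:
  assumes a: "a > 0"
  shows "a * A_pos d n a \<le> real (n + 1) * (real (card (fold_seqs n)) *
    (real (card (fold_seqs (2 * n + 1))) * sqrt (contact_sum d a (bridge_loops d (2 * n + 1)))))"
proof -
  let ?B = "real (card (fold_seqs n)) *
    (real (card (fold_seqs (2 * n + 1))) * sqrt (contact_sum d a (bridge_loops d (2 * n + 1))))"
  have "a * A_pos d n a = contact_sum d a (\<Union>k\<le>n. hs_walks d n 0 (int k))"
    by (simp add: contact_sum_pos_walks flip: pos_walks_eq_UN_hs_walks)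
  also have "\<dots> = (\<Sum>k\<le>n. contact_sum d a (hs_walks d n 0 (int k)))"
    unfolding contact_sum_def
    by (rule sum.UNION_disjoint) (auto simp: finite_hs_walks, auto simp: hs_walks_def)
  also have "\<dots> \<le> (\<Sum>k\<le>n. ?B)"
  proof (rule sum_mono)
    fix k
    have "?B\<^sup>2 = (real (card (fold_seqs n)))\<^sup>2 * ((real (card (fold_seqs (2 * n + 1))))\<^sup>2
        * contact_sum d a (bridge_loops d (2 * n + 1)))"
      using contact_sum_nonneg[OF a] by (simp add: power_mult_distrib)
    then have "(contact_sum d a (hs_walks d n 0 (int k)))\<^sup>2 \<le> ?B\<^sup>2"
      using contact_sum_hs_walks_square_le[OF d2 a, of n "int k"] by simp
    then show "contact_sum d a (hs_walks d n 0 (int k)) \<le> ?B"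
      by (rule power2_le_imp_le) (use contact_sum_nonneg[OF a] in auto)
  qed
  also have "\<dots> = real (n + 1) * ?B" by simp
  finally show ?thesis .
qed

text \<open>The witness is the straight walk along the wall in direction 0, all of whose n + 1
  vertices are contacts. It makes the logarithms meaningful and later yields F(a) \<ge> ln
  a.\<close>

lemma contact_sum_bridge_loops_ge:
  assumes a: "a > 0"
  shows "a ^ Suc n \<le> contact_sum d a (bridge_loops d n)"
proof -
  define v where "v i = (replicate d 0)[0 := int i]" for i
  define w where "w = map v [0..<Suc n]"
  have v: "v i ! j = (if j = 0 then int i else 0)" if "j < d" for i j
    using that by (simp add: v_def nth_list_update)
  have len: "length (v i) = d" for i by (simp add: v_def)
  have nth: "w ! i = v i" if "i \<le> n" for i using that by (simp add: w_def del: upt_Suc)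
  have set: "set w = v ` {..n}" by (auto simp: w_def less_Suc_eq_le simp del: upt_Suc)
  have last: "last w = v n" by (simp add: w_def)
  have lw: "lat_walk d n w"
    unfolding lat_walk_def
  proof (intro conjI allI impI)
    show "distinct w"
    proof -
      have "inj_on v A" for A
      proof (rule inj_onI)
        fix i k assume "v i = v k"
        then have "v i ! 0 = v k ! 0" by simp
        then show "i = k" using d2 by (simp add: v)
      qed
      then show ?thesis by (simp add: w_def distinct_map del: upt_Suc)
    qed
    show "lat_adj (w ! i) (w ! Suc i)" if "i < n" for i
    proof -
      have "(\<Sum>j<d. \<bar>v i ! j - v (Suc i) ! j\<bar>) = (\<Sum>j<d. if j = 0 then 1 else 0)"
        by (intro sum.cong) (auto simp: v)
      also have "\<dots> = 1" using d2 by (simp add: sum.delta)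
      finally show ?thesis using that by (simp add: nth lat_adj_def len)
    qed
  qed (auto simp: w_def len simp del: upt_Suc)
  have "v 0 = (replicate d 0)[d - 1 := 0]"
    by (rule nth_equalityI) (auto simp: len v replicate_update_same)
  then have "w \<in> hs_walks d n 0 0"
    using lw d2 by (auto simp: hs_walks_def nth set v)
  moreover have "min_start w" "max_end w"
    using d2 by (auto simp: min_start_def max_end_def set last nth v)
  ultimately have "{w} \<subseteq> bridge_loops d n" by (simp add: bridge_loops_def[OF d2])
  from contact_sum_mono[OF this finite_bridge_loops[OF d2] a]
  have "a ^ wall_contacts d w \<le> contact_sum d a (bridge_loops d n)" by (simp add: contact_sum_def)
  moreover have "filter (\<lambda>v. v ! (d - 1) = 0) w = w"
    using d2 by (auto simp: filter_id_conv set v)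
  then have "wall_contacts d w = Suc n" using lw by (simp add: wall_contacts_def lat_walk_length)
  ultimately show ?thesis by simp
qed

lemma A_pos_ge_power: "a > 0 \<Longrightarrow> a ^ n \<le> A_pos d n a"
  using order.trans[OF contact_sum_bridge_loops_ge contact_sum_bridge_loops_le, of a n] by simp

lemma A_pos_pos: "a > 0 \<Longrightarrow> 0 < A_pos d n a"
  using A_pos_ge_power[of a n] by (meson less_le_trans zero_less_power)

text \<open>Combines the step count with at most n + 1 contacts; the spare factor
  \<open>3 ^ d\<close> gives both bases the same exponent.\<close>

lemma contact_sum_bridge_loops_upper:
  assumes a: "a > 0"
  shows "contact_sum d a (bridge_loops d n) \<le> (max 1 a * 3 ^ d) ^ Suc n"
proof -
  have sub: "bridge_loops d n \<subseteq> {w. lat_walk d n w \<and> w ! 0 = (replicate d 0)[d - 1 := 0]}"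
    by (auto simp: bridge_loops_def[OF d2] hs_walks_def)
  have "a ^ wall_contacts d w \<le> max 1 a ^ Suc n" if "w \<in> bridge_loops d n" for w
  proof -
    have "wall_contacts d w \<le> Suc n"
      using subsetD[OF sub that] length_filter_le[of "\<lambda>v. v ! (d - 1) = 0" w] lat_walk_length[of d n w]
      unfolding wall_contacts_def by auto
    have "a ^ wall_contacts d w \<le> max 1 a ^ wall_contacts d w" using a by (intro power_mono) auto
    also have "\<dots> \<le> max 1 a ^ Suc n" using \<open>wall_contacts d w \<le> Suc n\<close> by (intro power_increasing) auto
    finally show ?thesis .
  qed
  then have "contact_sum d a (bridge_loops d n) \<le> real (card (bridge_loops d n)) * max 1 a ^ Suc n"
    unfolding contact_sum_def by (intro sum_bounded_above)
  also have "real (card (bridge_loops d n)) \<le> real ((3 ^ d) ^ n)"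
    unfolding of_nat_le_iff
    by (rule order.trans[OF card_mono[OF finite_lat_walks_from sub] card_lat_walks_from_le])
  also have "real ((3 ^ d) ^ n) \<le> (3 ^ d) ^ Suc n" by simp
  finally show ?thesis by (simp add: power_mult_distrib mult_ac mult_right_mono)
qed

text \<open>Lift a positive walk by one and prepend the origin. The result never returns to the
  wall, so its weight is 1 for every \<open>a\<close>, however small.\<close>

lemma A_pos_Suc_ge: 
  assumes a: "a > 0"
  shows "A_pos d n 1 \<le> A_pos d (Suc n) a"
proof -
  define T where "T v = map (\<lambda>k. if k = d - 1 then v ! k + 1 else v ! k) [0..<d]" for v :: "int list"
  define f where "f w = replicate d 0 # map T w" for w
  have len: "length (T v) = d" for v by (simp add: T_def)
  have Td: "T v ! (d - 1) = v ! (d - 1) + 1" for v using d2 by (simp add: T_def)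
  have f: "pos_walk d (Suc n) (f w)" "visits d (f w) = 0" if "pos_walk d n w" for w
  proof -
    have w: "lat_walk d n w" "w ! 0 = replicate d 0" "\<forall>v\<in>set w. 0 \<le> v ! (d - 1)"
      using that by (auto simp: pos_walk_def saw_iff)
    have *: "lat_walk d 0 [replicate d 0]" by (simp add: lat_walk_def)
    have "lat_walk d (0 + n + 1) ([replicate d 0] @ map T w)"
    proof (rule lat_walk_append[OF *])
      show "lat_walk d n (map T w)" using w(1) len by (rule lat_walk_map_isometry) (auto simp: T_def)
      have "(\<Sum>j<d. \<bar>replicate d 0 ! j - T (w ! 0) ! j\<bar>) = (\<Sum>j<d. if j = d - 1 then 1 else 0)"
        using w(2) by (intro sum.cong) (auto simp: T_def)
      also have "\<dots> = 1" using d2 by (simp add: sum.delta)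
      finally show "lat_adj ([replicate d 0] ! 0) (map T w ! 0)"
        using w(1) by (simp add: lat_adj_def len lat_walk_length)
      have "replicate d 0 \<noteq> T v" if "v \<in> set w" for v
      proof
        assume "replicate d 0 = T v"
        then have "T v ! (d - 1) = replicate d 0 ! (d - 1)" by simp
        with Td[of v] w(3) that d2 show False by force
      qed
      then show "set [replicate d 0] \<inter> set (map T w) = {}" by auto
    qed
    then show "pos_walk d (Suc n) (f w)"
      using w(3) d2 by (auto simp: pos_walk_def saw_iff f_def Td[simplified])
    have "f w ! i ! (d - 1) \<noteq> 0" if "1 \<le> i" "i < length (f w)" for i
    proof -
      from that have "w ! (i - 1) \<in> set w" "f w ! i = T (w ! (i - 1))"
        by (auto simp: f_def nth_Cons')
      with w(3) Td[of "w ! (i - 1)"] show ?thesis by force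
    qed
    then have "{i. 1 \<le> i \<and> i < length (f w) \<and> f w ! i ! (d - 1) = 0} = {}" by auto
    then show "visits d (f w) = 0" by (simp add: visits_def)
  qed
  have inj: "inj_on f {w. pos_walk d n w}"
  proof (rule inj_onI, clarsimp)
    fix w u assume wu: "pos_walk d n w" "pos_walk d n u" and "f w = f u"
    then have "map T w = map T u" by (simp add: f_def)
    moreover have "inj_on T (set w \<union> set u)"
    proof (rule inj_onI)
      fix x y assume "x \<in> set w \<union> set u" "y \<in> set w \<union> set u" and eq: "T x = T y"
      then have l: "length x = d" "length y = d" using wu by (auto simp: pos_walk_def saw_def)
      show "x = y"
      proof (rule nth_equalityI)
        fix j assume "j < length x"
        with l have "j < d" by simp
        moreover from eq have "T x ! j = T y ! j" by simp
        ultimately show "x ! j = y ! j" by (auto simp: T_def split: if_splits)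
      qed (simp add: l)
    qed
    ultimately show "w = u" by (simp add: inj_on_map_eq_map)
  qed
  have "A_pos d n 1 = (\<Sum>w\<in>f ` {w. pos_walk d n w}. a ^ visits d w)"
    using f(2) by (simp add: A_pos_1 sum.reindex[OF inj])
  also have "\<dots> \<le> A_pos d (Suc n) a"
    unfolding A_pos_eq_sum using f(1) a by (intro sum_mono2 finite_pos_walks) auto
  finally show ?thesis .
qed

text \<open>After unfolding in the last coordinate the walk ends at its greatest height; seen from
  that end and turned upside down it is a positive walk. Contacts need not be preserved at weight 1,
  so folding the height is allowed.\<close>

lemma c_saw_le_A_pos_1: "real (c_saw d n) \<le> real (card (fold_seqs n)) * A_pos d n 1"
proof -
  define j where "j = d - 1"
  have j: "j < d" using d2 by (simp add: j_def)
  \<comment> \<open>In contrast to \<open>reverse_walk\<close>, the height is reflected too.\<close>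
  define R where "R w = map (\<lambda>v. map (\<lambda>k. last w ! k - v ! k) [0..<d]) (rev w)" for w :: "int list list"
  let ?M = "{w. saw d n w \<and> (\<forall>v\<in>set w. v ! j \<le> last w ! j)}"
  have finM: "finite ?M" by (rule finite_subset[OF _ finite_saws[of d n]]) auto
  have "(\<Sum>w | saw d n w. 1 :: real) \<le> real (card (fold_seqs n)) * (\<Sum>w\<in>?M. 1)"
  proof (rule sum_le_card_mult_sum[where \<phi> = "unfold_coord j"])
    show "inj_on (unfold_coord j S) {w. saw d n w}" if "S \<in> fold_seqs n" for S
      by (rule inj_on_subset[OF inj_on_unfold_coord[OF that j]]) (auto simp: saw_iff)
    show "\<exists>S\<in>fold_seqs n. unfold_coord j S w \<in> ?M \<and> (1::real) = 1" if "w \<in> {w. saw d n w}" for w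
    proof -
      from that have w: "lat_walk d n w" "w ! 0 = replicate d 0" by (auto simp: saw_iff)
      obtain S where S: "S \<in> fold_seqs n" "lat_walk d n (unfold_coord j S w)"
        "\<And>i. i \<le> n \<Longrightarrow> unfold_coord j S w ! i ! j \<le> unfold_coord j S w ! n ! j"
        "\<And>i. \<forall>k\<le>n. w ! 0 ! j \<le> w ! k ! j \<Longrightarrow> i \<le> n \<Longrightarrow> w ! 0 ! j \<le> unfold_coord j S w ! i ! j"
        by (rule unfold_walk[OF w(1) j]) (rule that)
      then have "unfold_coord j S w \<in> ?M"
        using w by (auto simp: saw_iff unfold_coord_start[OF w(1)] lat_walk_last[OF S(2)] lat_walk_set_conv[OF S(2)])
      with S(1) show ?thesis by blast
    qed
  qed (use finM in \<open>auto simp: finite_fold_seqs\<close>)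
  also have "(\<Sum>w\<in>?M. 1 :: real) = real (card ?M)" by simp
  also have "card ?M \<le> card {w. pos_walk d n w}"
  proof (rule card_inj_on_le[OF _ _ finite_pos_walks])
    show "R ` ?M \<subseteq> {w. pos_walk d n w}"
    proof (clarsimp)
      fix w assume w: "saw d n w" and max: "\<forall>v\<in>set w. v ! j \<le> last w ! j"
      then have lw: "lat_walk d n w" by (simp add: saw_iff)
      have "lat_walk d n (R w)"
        unfolding R_def by (rule lat_walk_map_isometry[OF lat_walk_rev[OF lw]]) auto
      moreover have "R w ! 0 = replicate d 0"
        using lw by (intro nth_equalityI) (auto simp: R_def rev_nth lat_walk_length lat_walk_last)
      moreover have "0 \<le> v ! j" if "v \<in> set (R w)" for v
        using that max j by (auto simp: R_def)
      ultimately show "pos_walk d n (R w)" by (auto simp: pos_walk_def saw_iff j_def)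
    qed
    show "inj_on R ?M"
    proof (rule inj_on_inverseI[where g = R])
      fix w assume "w \<in> ?M"
      then have w: "lat_walk d n w" "w ! 0 = replicate d 0" by (auto simp: saw_iff)
      have last: "last (R w) ! k = last w ! k" if "k < d" for k
        using w that lat_walk_length[OF w(1)]
        by (subst last_conv_nth) (auto simp: R_def rev_nth)
      show "R (R w) = w"
      proof (rule nth_equalityI)
        fix i assume "i < length (R (R w))"
        then have i: "i < length w" by (simp add: R_def)
        then have len: "length (w ! i) = d" using w by (auto simp: lat_walk_def)
        show "R (R w) ! i = w ! i"
        proof (rule nth_equalityI)
          fix k assume "k < length (R (R w) ! i)"
          then have "k < d" using i by (simp add: R_def)
          with i last[of k] show "R (R w) ! i ! k = w ! i ! k"
            by (simp add: R_def[of "R w"]) (simp add: R_def rev_map rev_nth)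
        qed (use i len in \<open>simp add: R_def\<close>)
      qed (simp add: R_def)
    qed
  qed
  finally show ?thesis
    by (simp add: c_saw_def A_pos_1 mult_left_mono)
qed

end

section \<open>Zeros of polynomials with subexponential coefficients\<close>

lemma norm2_le_square_sum_cmod:
  fixes p :: "complex poly"
  shows "norm2 p \<le> (\<Sum>k\<le>degree p. cmod (coeff p k))\<^sup>2"
proof (cases "p = 0")
  case False
  let ?s = "\<Sum>k\<le>degree p. cmod (coeff p k)"
  have "norm2 p = (\<Sum>k\<leftarrow>[0..<Suc (degree p)]. (cmod (coeff p k))\<^sup>2)"
    using False by (simp add: coeffs_def o_def del: upt_Suc)
  also have "\<dots> = (\<Sum>k\<in>{0..<Suc (degree p)}. (cmod (coeff p k))\<^sup>2)"
    by (simp only: interv_sum_list_conv_sum_set_nat set_upt)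
  also have "\<dots> = (\<Sum>k\<le>degree p. (cmod (coeff p k))\<^sup>2)"
    by (simp only: atLeast0LessThan lessThan_Suc_atMost)
  also have "\<dots> \<le> (\<Sum>k\<le>degree p. cmod (coeff p k) * ?s)"
    unfolding power2_eq_square
    by (intro sum_mono mult_left_mono member_le_sum) auto
  also have "\<dots> = ?s\<^sup>2"
    by (simp add: sum_distrib_right power2_eq_square)
  finally show ?thesis .
qed simp

text \<open>Landau's inequality bounds the left side by the l2 norm of the coefficients; the larger
  l1 norm is easier to estimate and equally good on the exponential scale.\<close>

lemma mahler_le_sum_cmod:
  fixes p :: "complex poly"
  shows "cmod (lead_coeff p) * (\<Prod>z\<in>#proots p. max 1 (cmod z)) \<le> (\<Sum>k\<le>degree p. cmod (coeff p k))"
proof -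
  obtain zs where zs: "mset zs = proots p" using ex_mset by blast
  have "p = smult (lead_coeff p) (\<Prod>z\<leftarrow>zs. [:- z, 1:])"
    using complex_poly_decompose_multiset[of p] zs
    by (metis mset_map prod_mset_prod_list)
  then have "mahler_measure_poly p = cmod (lead_coeff p) * (\<Prod>z\<leftarrow>zs. max 1 (cmod z))"
    by (metis mahler_measure_poly_explicit)
  also have "(\<Prod>z\<leftarrow>zs. max 1 (cmod z)) = (\<Prod>z\<in>#proots p. max 1 (cmod z))"
    by (metis mset_map prod_mset_prod_list zs)
  finally have "cmod (lead_coeff p) * (\<Prod>z\<in>#proots p. max 1 (cmod z)) \<le> l2norm_complex p"
    using Landau_inequality[of p] by simp
  also have "\<dots> \<le> (\<Sum>k\<le>degree p. cmod (coeff p k))"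
    using norm2_le_square_sum_cmod[of p] by (intro real_le_lsqrt) (auto simp: sum_nonneg)
  finally show ?thesis .
qed

lemma cmod_coeff_0_eq_prod_proots:
  fixes p :: "complex poly"
  shows "cmod (coeff p 0) = cmod (lead_coeff p) * (\<Prod>z\<in>#proots p. cmod z)"
proof -
  have "poly p 0 = poly (smult (lead_coeff p) (\<Prod>z\<in>#proots p. [:- z, 1:])) 0"
    by (simp only: complex_poly_decompose_multiset)
  also have "\<dots> = lead_coeff p * (\<Prod>z\<in>#proots p. - z)"
    by (simp add: poly_prod_mset image_mset.compositionality o_def)
  also have "cmod \<dots> = cmod (lead_coeff p) * (\<Prod>z\<in>#proots p. cmod z)"
  proof -
    have "cmod (\<Prod>z\<in>#M. - z) = (\<Prod>z\<in>#M. cmod z)" for M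
      by (induction M) (auto simp: norm_mult)
    then show ?thesis by (simp add: norm_mult)
  qed
  finally show ?thesis by (simp add: poly_0_coeff_0)
qed

text \<open>A multiplicative Markov inequality: elements satisfying \<open>P\<close> contribute at
  least \<open>b\<close> each, and the others do not shrink the product.\<close>

lemma power_size_filter_le_prod_mset:
  fixes f :: "'a \<Rightarrow> real"
  assumes "b \<ge> 0" "\<And>x. x \<in># M \<Longrightarrow> f x \<ge> 1" "\<And>x. x \<in># M \<Longrightarrow> P x \<Longrightarrow> f x \<ge> b"
  shows "b ^ size {#x \<in># M. P x#} \<le> (\<Prod>x\<in>#M. f x)"
  using assms(2,3)
proof (induction M)
  case (add x M)
  then have IH: "b ^ size {#x \<in># M. P x#} \<le> (\<Prod>x\<in>#M. f x)" by simp
  show ?case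
  proof (cases "P x")
    case True
    with IH add.prems assms(1) show ?thesis by (auto intro!: mult_mono order.trans[of 0 b "f x"])
  next
    case False
    have "1 * b ^ size {#x \<in># M. P x#} \<le> f x * (\<Prod>x\<in>#M. f x)"
      using IH add.prems assms(1) by (intro mult_mono) (auto intro: order.trans[of 0 1 "f x"])
    with False show ?thesis by simp
  qed
qed auto

lemma outer_zeros_bound:
  fixes p :: "complex poly"
  assumes "0 < r" "r < 1"
  shows "cmod (lead_coeff p) * (1 / r) ^ size {#z \<in># proots p. 1 / r < cmod z#}
           \<le> (\<Sum>k\<le>degree p. cmod (coeff p k))"
proof -
  have "(1 / r) ^ size {#z \<in># proots p. 1 / r < cmod z#} \<le> (\<Prod>z\<in>#proots p. max 1 (cmod z))"
    using assms by (intro power_size_filter_le_prod_mset) auto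
  from mult_left_mono[OF this, of "cmod (lead_coeff p)"] mahler_le_sum_cmod[of p]
  show ?thesis by simp
qed

text \<open>By Vieta the Mahler measure can also be computed from the constant coefficient, as |z|
  max(1, 1/|z|) = max(1, |z|) for nonzero z. Each zero with |z| < r then contributes a factor above
  1/r, as an outer zero of the reciprocal polynomial would.\<close>

lemma inner_zeros_bound:
  fixes p :: "complex poly"
  assumes r: "0 < r" "r < 1" and nz: "coeff p 0 \<noteq> 0"
  shows "cmod (coeff p 0) * (1 / r) ^ size {#z \<in># proots p. cmod z < r#}
           \<le> (\<Sum>k\<le>degree p. cmod (coeff p k))"
proof -
  have z0: "z \<noteq> 0" if "z \<in># proots p" for z
    using that nz by (cases "p = 0") (auto simp: poly_0_coeff_0)
  have "1 / r \<le> 1 / cmod z" if "z \<in># proots p" "cmod z < r" for z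
    using z0[OF that(1)] that(2) r by (intro divide_left_mono) auto
  then have "(1 / r) ^ size {#z \<in># proots p. cmod z < r#} \<le> (\<Prod>z\<in>#proots p. max 1 (1 / cmod z))"
    using r by (intro power_size_filter_le_prod_mset) (auto simp: le_max_iff_disj)
  from mult_left_mono[OF this norm_ge_zero[of "coeff p 0"]]
  have "cmod (coeff p 0) * (1 / r) ^ size {#z \<in># proots p. cmod z < r#}
          \<le> cmod (lead_coeff p) * ((\<Prod>z\<in>#proots p. cmod z) * (\<Prod>z\<in>#proots p. max 1 (1 / cmod z)))"
    by (simp add: cmod_coeff_0_eq_prod_proots mult_ac)
  also have "(\<Prod>z\<in>#proots p. cmod z) * (\<Prod>z\<in>#proots p. max 1 (1 / cmod z))
               = (\<Prod>z\<in>#proots p. cmod z * max 1 (1 / cmod z))"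
    by (simp add: prod_mset.distrib)
  also have "\<dots> = (\<Prod>z\<in>#proots p. max 1 (cmod z))"
    using z0 by (intro arg_cong[of _ _ prod_mset] image_mset_cong) (auto simp: max_def field_simps)
  also have "cmod (lead_coeff p) * \<dots> \<le> (\<Sum>k\<le>degree p. cmod (coeff p k))"
    by (rule mahler_le_sum_cmod)
  finally show ?thesis .
qed

text \<open>Half of \<open>\<delta>\<close> bounds the single coefficients, the other half absorbs
  the number of terms and the constant.\<close>

lemma ln_partial_sum_subexponential:
  fixes c :: "nat \<Rightarrow> real"
  assumes pos: "\<And>n. c n > 0" and lim: "(\<lambda>n. ln (c n) / n) \<longlonglongrightarrow> 0" and \<delta>: "\<delta> > 0"
  shows "\<forall>\<^sub>F N in sequentially. ln (\<Sum>k\<le>N. c k) \<le> \<delta> * real N"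
proof -
  have "\<forall>\<^sub>F n in sequentially. \<bar>ln (c n) / n\<bar> < \<delta> / 2"
    using tendstoD[OF lim, of "\<delta> / 2"] \<delta> by simp
  then obtain n0 where n0: "\<And>n. n \<ge> n0 \<Longrightarrow> \<bar>ln (c n) / n\<bar> < \<delta> / 2"
    by (auto simp: eventually_sequentially)
  \<comment> \<open>The sum takes care of the finitely many indices up to \<open>n0\<close>; the
    added 1 gives \<open>C \<ge> 1\<close>, so multiplying by \<open>C\<close> does no harm beyond
    them.\<close>
  define C where "C = 1 + (\<Sum>k\<le>n0. c k)"
  have C: "C \<ge> 1" using pos by (simp add: C_def sum_nonneg less_imp_le)
  have c_le: "c n \<le> C * exp (\<delta> / 2 * real n)" for n
  proof (cases "n \<le> n0")
    case True
    then have "c n \<le> C * 1" using pos member_le_sum[of n "{..n0}" c] by (auto simp: C_def less_imp_le)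
    also have "\<dots> \<le> C * exp (\<delta> / 2 * real n)" using C \<delta> by (intro mult_left_mono) auto
    finally show ?thesis .
  next
    case False
    then have "ln (c n) \<le> \<delta> / 2 * real n" using n0[of n] by (simp add: field_simps abs_less_iff)
    then have "c n \<le> exp (\<delta> / 2 * real n)" using pos[of n] by (metis exp_le_cancel_iff exp_ln)
    also have "\<dots> \<le> C * exp (\<delta> / 2 * real n)" using C by simp
    finally show ?thesis .
  qed
  have bound: "ln (\<Sum>k\<le>N. c k) \<le> ln (real N + 1) + ln C + \<delta> / 2 * real N" for N
  proof -
    have "(\<Sum>k\<le>N. c k) \<le> (\<Sum>k\<le>N. C * exp (\<delta> / 2 * real N))"
      using C \<delta> by (intro sum_mono order.trans[OF c_le] mult_left_mono) auto
    also have "\<dots> = (real N + 1) * (C * exp (\<delta> / 2 * real N))" by simp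
    finally have "ln (\<Sum>k\<le>N. c k) \<le> ln ((real N + 1) * (C * exp (\<delta> / 2 * real N)))"
      using pos by (subst ln_le_cancel_iff) (use C in \<open>auto intro!: sum_pos mult_pos_pos\<close>)
    also have "\<dots> = ln (real N + 1) + (ln C + \<delta> / 2 * real N)"
      using C by (subst ln_mult) (auto simp: ln_mult)
    finally show ?thesis by simp
  qed
  have "\<forall>\<^sub>F N in sequentially. ln (real N + 1) + ln C \<le> \<delta> / 2 * real N"
    using \<delta> by real_asymp
  then show ?thesis
  proof eventually_elim
    case (elim N)
    with bound[of N] show ?case by linarith
  qed
qed

lemma zeros_near_unit_circle:
  fixes c :: "nat \<Rightarrow> real"
  assumes pos: "\<And>n. c n > 0" and lim: "(\<lambda>n. ln (c n) / n) \<longlonglongrightarrow> 0"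
    and r: "0 < r" "r < 1" and \<epsilon>: "\<epsilon> > 0"
  shows "\<forall>\<^sub>F N in sequentially.
    \<bar>1 - real (size {#z \<in># proots (\<Sum>n\<le>N. monom (complex_of_real (c n)) n).
                      r \<le> cmod z \<and> cmod z \<le> 1 / r#}) / real N\<bar> < \<epsilon>"
proof -
  define L where "L = ln (1 / r)"
  have L: "L > 0" using r by (simp add: L_def)
  \<comment> \<open>Four errors of size \<open>\<delta> * N\<close> occur: \<open>ln S\<close> for
    the outer and again for the inner zeros, \<open>- ln (c N)\<close> and
    \<open>- ln (c 0)\<close>. The fifth part leaves room for strictness.\<close>
  define \<delta> where "\<delta> = \<epsilon> * L / 5"
  have \<delta>: "\<delta> > 0" using \<epsilon> L by (simp add: \<delta>_def)
  have "\<forall>\<^sub>F N in sequentially. \<bar>ln (c N) / real N\<bar> < \<delta>"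
    using tendstoD[OF lim \<delta>] by simp
  moreover have "\<forall>\<^sub>F N in sequentially. - ln (c 0) \<le> \<delta> * real N"
    using \<delta> by real_asymp
  moreover note ln_partial_sum_subexponential[OF pos lim \<delta>] eventually_ge_at_top[of "1::nat"]
  ultimately show ?thesis
  proof eventually_elim
    case (elim N)
    define p where "p = (\<Sum>n\<le>N. monom (complex_of_real (c n)) n)"
    define S where "S = (\<Sum>k\<le>N. c k)"
    have coeff: "coeff p k = (if k \<le> N then complex_of_real (c k) else 0)" for k
      by (simp add: p_def coeff_sum)
    have deg: "degree p = N"
      using pos[of N] by (intro antisym degree_le le_degree) (auto simp: coeff)
    have S: "(\<Sum>k\<le>degree p. cmod (coeff p k)) = S"
      unfolding S_def deg using pos by (intro sum.cong) (auto simp: coeff less_imp_le)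
    have Spos: "S > 0" using pos by (auto simp: S_def intro!: sum_pos)
    let ?o = "size {#z \<in># proots p. 1 / r < cmod z#}"
    let ?i = "size {#z \<in># proots p. cmod z < r#}"
    let ?m = "size {#z \<in># proots p. r \<le> cmod z \<and> cmod z \<le> 1 / r#}"
    have log_bound: "real k * L \<le> ln S - ln x" if "x * (1 / r) ^ k \<le> S" "x > 0" for x k
    proof -
      have "ln (x * (1 / r) ^ k) \<le> ln S" using that r Spos by (subst ln_le_cancel_iff) auto
      also have "ln (x * (1 / r) ^ k) = ln x + real k * L"
        using that r by (simp add: ln_mult L_def ln_realpow ln_div)
      finally show ?thesis by simp
    qed
    have "real ?o * L \<le> ln S - ln (c N)"
      using outer_zeros_bound[OF r, of p, unfolded S] pos[of N]
      by (intro log_bound) (simp_all add: deg coeff)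
    moreover have "real ?i * L \<le> ln S - ln (c 0)"
      using inner_zeros_bound[OF r, of p, unfolded S] pos[of 0]
      by (intro log_bound) (simp_all add: coeff)
    moreover have "- ln (c N) \<le> \<delta> * real N" using elim by (simp add: field_simps abs_less_iff)
    ultimately have "(real ?o + real ?i) * L \<le> 4 * (\<delta> * real N)"
      using elim(2,3) by (simp add: S_def distrib_right)
    then have small: "real ?o + real ?i \<le> 4 / 5 * (\<epsilon> * real N)"
    proof -
      have "L * (real ?o + real ?i) \<le> L * (4 / 5 * (\<epsilon> * real N))"
        using \<open>(real ?o + real ?i) * L \<le> _\<close> by (simp add: \<delta>_def mult_ac)
      then show ?thesis using L by (simp only: mult_le_cancel_left_pos)
    qed
    have "size (proots p) = ?o + ?i + ?m"
    proof -
      \<comment> \<open>With \<open>r < 1 / r\<close> no zero is counted both as inner and as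
        outer.\<close>
      have "1 < 1 / r" using r by simp
      with r have "r < 1 / r" by linarith
      then have "size M = size {#z \<in># M. 1 / r < cmod z#} + size {#z \<in># M. cmod z < r#}
                 + size {#z \<in># M. r \<le> cmod z \<and> cmod z \<le> 1 / r#}" for M
        by (induction M) auto
      then show ?thesis .
    qed
    then have "real N = real ?o + real ?i + real ?m"
      using size_proots_complex[of p] deg by linarith
    then have "1 - real ?m / real N = (real ?o + real ?i) / real N"
      using elim(4) by (simp add: field_simps)
    also have "\<bar>\<dots>\<bar> \<le> 4 / 5 * \<epsilon>" using small elim(4) by (simp add: field_simps)
    also have "\<dots> < \<epsilon>" using \<epsilon> by simp
    finally show ?case unfolding p_def .
  qed
qed

lemma nu_eq_size_proots:
  assumes "g_poly d N a \<noteq> 0"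
  shows "nu d N a \<rho> = size {#z \<in># proots (g_poly d N a). 1 - \<rho> \<le> cmod z \<and> cmod z \<le> 1 / (1 - \<rho>)#}"
proof -
  let ?M = "{#z \<in># proots (g_poly d N a). 1 - \<rho> \<le> cmod z \<and> cmod z \<le> 1 / (1 - \<rho>)#}"
  have "set_mset ?M = {z. poly (g_poly d N a) z = 0 \<and> 1 - \<rho> \<le> cmod z \<and> cmod z \<le> 1 / (1 - \<rho>)}"
    using assms by auto
  then show ?thesis
    unfolding nu_def size_multiset_overloaded_eq using assms by (intro sum.cong) auto
qed

section \<open>Free energy and growth constant\<close>

text \<open>Index 0 is excluded because the sequence used later is shifted by one, and its value at
  0 is an artefact of truncated subtraction for which superadditivity can fail.\<close>

lemma fekete_superadditive:
  fixes u :: "nat \<Rightarrow> real"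
  assumes super: "\<And>m n. 1 \<le> m \<Longrightarrow> 1 \<le> n \<Longrightarrow> u m + u n \<le> u (m + n)"
    and bound: "\<And>n. 1 \<le> n \<Longrightarrow> u n \<le> C * real n"
  shows "convergent (\<lambda>n. u n / real n)"
proof -
  define L where "L = (SUP n\<in>{1..}. u n / real n)"
  have bdd: "bdd_above ((\<lambda>n. u n / real n) ` {1..})"
  proof (rule bdd_aboveI2[where M = C])
    fix n :: nat assume "n \<in> {1..}"
    then show "u n / real n \<le> C" using bound[of n] by (simp add: divide_le_eq)
  qed
  have "(\<lambda>n. u n / real n) \<longlonglongrightarrow> L"
  proof (rule LIMSEQ_I)
    fix \<epsilon> :: real assume \<epsilon>: "\<epsilon> > 0"
    then have "L - \<epsilon> / 2 < (SUP n\<in>{1..}. u n / real n)" by (simp add: L_def)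
    moreover have "{1::nat..} \<noteq> {}" by simp
    ultimately have "\<exists>m\<in>{1..}. L - \<epsilon> / 2 < u m / real m"
      using less_cSUP_iff[OF _ bdd] by blast
    then obtain m where m: "1 \<le> m" "L - \<epsilon> / 2 < u m / real m" by auto
    define s where "s = u m / real m"
    define b where "b = Min (u ` {1..m})"
    have iter: "real q * u m + u r \<le> u (q * m + r)" if "1 \<le> r" for q r
    proof (induction q)
      case (Suc q)
      have "u m + u (q * m + r) \<le> u (m + (q * m + r))" using m(1) that by (intro super) auto
      with Suc show ?case by (simp add: algebra_simps)
    qed simp
    have lower: "s * real n - (\<bar>s\<bar> * real m + \<bar>b\<bar>) \<le> u n" if n: "1 \<le> n" for n
    proof -
      define q where "q = (n - 1) div m"
      \<comment> \<open>The remainder is taken in 1..m instead of 0..m - 1, so that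
        \<open>u r\<close> has an admissible index.\<close>
      define r where "r = (n - 1) mod m + 1"
      have r: "1 \<le> r" "r \<le> m" using m(1) by (auto simp: r_def Suc_le_eq)
      have "q * m + (n - 1) mod m = n - 1" unfolding q_def by (rule div_mult_mod_eq)
      then have n_eq: "n = q * m + r" using n by (simp add: r_def)
      have "b \<le> u r" unfolding b_def using r by (intro Min_le) auto
      moreover have "real q * u m = s * real n - s * real r"
      proof -
        have "real n = real q * real m + real r"
          unfolding of_nat_mult[symmetric] of_nat_add[symmetric] of_nat_eq_iff by (rule n_eq)
        moreover have "s * real m = u m" using m(1) by (simp add: s_def)
        ultimately show ?thesis by (simp add: distrib_left mult.left_commute)
      qed
      moreover have "s * real r \<le> \<bar>s\<bar> * real m" using r by (intro mult_mono) auto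
      moreover have "real q * u m + u r \<le> u n" unfolding n_eq by (rule iter[OF r(1)])
      ultimately show ?thesis by linarith
    qed
    have "(\<lambda>n. (\<bar>s\<bar> * real m + \<bar>b\<bar>) / real n) \<longlonglongrightarrow> 0" by real_asymp
    then have "\<forall>\<^sub>F n in sequentially. (\<bar>s\<bar> * real m + \<bar>b\<bar>) / real n < \<epsilon> / 2"
      by (rule order_tendstoD) (use \<epsilon> in simp)
    then obtain n0 where n0: "\<And>n. n0 \<le> n \<Longrightarrow> (\<bar>s\<bar> * real m + \<bar>b\<bar>) / real n < \<epsilon> / 2"
      unfolding eventually_sequentially by blast
    have "norm (u n / real n - L) < \<epsilon>" if "max 1 n0 \<le> n" for n
    proof -
      have "u n / real n \<le> L" unfolding L_def using that by (intro cSUP_upper bdd) auto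
      moreover have "s - (\<bar>s\<bar> * real m + \<bar>b\<bar>) / real n \<le> u n / real n"
        using divide_right_mono[OF lower[of n], of "real n"] that by (simp add: diff_divide_distrib)
      moreover have "(\<bar>s\<bar> * real m + \<bar>b\<bar>) / real n < \<epsilon> / 2" using n0 that by simp
      ultimately show ?thesis using m(2)[folded s_def] \<epsilon> unfolding real_norm_def by linarith
    qed
    then show "\<exists>no. \<forall>n\<ge>no. norm (u n / real n - L) < \<epsilon>" by blast
  qed
  then show ?thesis by (rule convergentI)
qed

lemma ln_card_fold_seqs_le:
  "ln (real (card (fold_seqs n))) \<le> (sqrt (2 * real n) + 1) * ln (real n + 2)"
  "0 < real (card (fold_seqs n))"
proof -
  have "[] \<in> fold_seqs n" by (simp add: fold_seqs_def)
  then have "0 < card (fold_seqs n)" using finite_fold_seqs card_gt_0_iff by blast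
  then have pos: "1 \<le> real (card (fold_seqs n))" by linarith
  then show "0 < real (card (fold_seqs n))" by simp
  have "ln (real (card (fold_seqs n))) \<le> ln ((real n + 2) powr (sqrt (2 * real n) + 1))"
    using card_fold_seqs_le[of n] pos by (subst ln_le_cancel_iff) auto
  then show "ln (real (card (fold_seqs n))) \<le> (sqrt (2 * real n) + 1) * ln (real n + 2)"
    by (simp add: ln_powr)
qed

context
  fixes d :: nat
  assumes d2: "2 \<le> d"
begin

lemma free_energy_limit:
  assumes a: "a > 0"
  shows "(\<lambda>n. ln (A_pos d n a) / real n) \<longlonglongrightarrow> free_energy d a"
proof -
  define z where "z n = ln (contact_sum d a (bridge_loops d n))" for n
  \<comment> \<open>The shift absorbs the joining step: (m - 1) + (n - 1) + 1 = (m + n) - 1.\<close>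
  define u where "u n = z (n - 1)" for n
  have pos: "0 < contact_sum d a (bridge_loops d n)" for n
    using contact_sum_bridge_loops_ge[OF d2 a, of n] a by (meson less_le_trans zero_less_power)
  have Apos: "0 < A_pos d n a" for n using A_pos_pos[OF d2 a] .
  have "convergent (\<lambda>n. u n / real n)"
  proof (rule fekete_superadditive)
    fix m n :: nat assume mn: "1 \<le> m" "1 \<le> n"
    have "z (m - 1) + z (n - 1) = ln (contact_sum d a (bridge_loops d (m - 1)) * contact_sum d a (bridge_loops d (n - 1)))"
      using pos[of "m - 1"] pos[of "n - 1"] by (simp add: z_def ln_mult)
    also have "\<dots> \<le> z (m - 1 + (n - 1) + 1)"
      unfolding z_def using pos contact_sum_bridge_loops_supermult[OF d2 a] by (subst ln_le_cancel_iff) auto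
    also have "m - 1 + (n - 1) + 1 = m + n - 1" using mn by simp
    finally show "u m + u n \<le> u (m + n)" by (simp add: u_def)
  next
    fix n :: nat assume n: "1 \<le> n"
    have "z (n - 1) \<le> ln ((max 1 a * 3 ^ d) ^ Suc (n - 1))"
      unfolding z_def using pos contact_sum_bridge_loops_upper[OF d2 a, of "n - 1"] by (subst ln_le_cancel_iff) auto
    also have "\<dots> = ln (max 1 a * 3 ^ d) * real n" using n by (subst ln_realpow) auto
    finally show "u n \<le> ln (max 1 a * 3 ^ d) * real n" by (simp add: u_def)
  qed
  then obtain L where L: "(\<lambda>n. u n / real n) \<longlonglongrightarrow> L" by (auto simp: convergent_def)
  have "(\<lambda>n. u (Suc n) / real (Suc n) * (real (Suc n) / real n) - ln a / real n) \<longlonglongrightarrow> L * 1 - 0"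
    by (intro tendsto_intros LIMSEQ_Suc[OF L]; real_asymp)
  then have lower: "(\<lambda>n. u (Suc n) / real (Suc n) * (real (Suc n) / real n) - ln a / real n) \<longlonglongrightarrow> L" by simp
  \<comment> \<open>The terms are the logarithms of the number of end heights, of the bounds on fold
    lists for lengths n and 2n + 1, and of the contact at the origin; all are o(n).\<close>
  define e where "e n = ln (real n + 1) + (sqrt (2 * real n) + 1) * ln (real n + 2)
    + (sqrt (2 * (2 * real n + 1)) + 1) * ln (2 * real n + 3) - ln a" for n :: nat
  have "filterlim (\<lambda>n::nat. 2 * n + 2) at_top sequentially" by real_asymp
  from filterlim_compose[OF L this]
  \<comment> \<open>The square root halves \<open>z (2 * n + 1) = u (2 * n + 2)\<close>, so dividing
    by n amounts to dividing \<open>u (2 * n + 2)\<close> by 2n.\<close>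
  have "(\<lambda>n. e n / real n + u (2 * n + 2) / real (2 * n + 2) * (real (2 * n + 2) / (2 * real n))) \<longlonglongrightarrow> 0 + L * 1"
    unfolding e_def by (intro tendsto_intros; (assumption | real_asymp))
  then have upper: "(\<lambda>n. e n / real n + u (2 * n + 2) / real (2 * n + 2) * (real (2 * n + 2) / (2 * real n))) \<longlonglongrightarrow> L"
    by simp
  have "(\<lambda>n. ln (A_pos d n a) / real n) \<longlonglongrightarrow> L"
  proof (rule tendsto_sandwich[OF _ _ lower upper])
    show "\<forall>\<^sub>F n in sequentially. u (Suc n) / real (Suc n) * (real (Suc n) / real n) - ln a / real n
            \<le> ln (A_pos d n a) / real n"
      using eventually_gt_at_top[of 0]
    proof eventually_elim
      case (elim n)
      have "z n \<le> ln (a * A_pos d n a)"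
        unfolding z_def using pos Apos a contact_sum_bridge_loops_le[OF d2 a] by (subst ln_le_cancel_iff) auto
      then have "z n - ln a \<le> ln (A_pos d n a)" using a Apos[of n] by (simp add: ln_mult)
      then have "(z n - ln a) / real n \<le> ln (A_pos d n a) / real n" by (intro divide_right_mono) auto
      then show ?case by (simp add: u_def diff_divide_distrib)
    qed
    show "\<forall>\<^sub>F n in sequentially. ln (A_pos d n a) / real n
            \<le> e n / real n + u (2 * n + 2) / real (2 * n + 2) * (real (2 * n + 2) / (2 * real n))"
      using eventually_gt_at_top[of 0]
    proof eventually_elim
      case (elim n)
      let ?T = "\<lambda>n. real (card (fold_seqs n))"
      have "ln a + ln (A_pos d n a) = ln (a * A_pos d n a)" using a Apos[of n] by (simp add: ln_mult)
      also have "\<dots> \<le> ln (real (n + 1) * (?T n * (?T (2 * n + 1) * sqrt (contact_sum d a (bridge_loops d (2 * n + 1))))))"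
        using a Apos[of n] A_pos_le_bridge_loops[OF d2 a, of n] ln_card_fold_seqs_le(2) pos
        by (subst ln_le_cancel_iff) (auto intro!: mult_pos_pos)
      also have "\<dots> = ln (real (n + 1)) + (ln (?T n) + (ln (?T (2 * n + 1)) + z (2 * n + 1) / 2))"
        using ln_card_fold_seqs_le(2)[of n] ln_card_fold_seqs_le(2)[of "2 * n + 1"] pos[of "2 * n + 1"]
        by (simp add: ln_mult ln_sqrt z_def)
      finally have "ln (A_pos d n a) \<le> e n + z (2 * n + 1) / 2"
        using ln_card_fold_seqs_le(1)[of n] ln_card_fold_seqs_le(1)[of "2 * n + 1"]
        by (simp add: e_def algebra_simps)
      then have "ln (A_pos d n a) / real n \<le> (e n + z (2 * n + 1) / 2) / real n"
        by (intro divide_right_mono) auto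
      moreover have "x / y * (y / (2 * w)) = x / 2 / w" if "y \<noteq> 0" for x y w :: real
        using that by simp
      from this[of "real (2 * n + 2)" "u (2 * n + 2)" "real n"]
      have "u (2 * n + 2) / real (2 * n + 2) * (real (2 * n + 2) / (2 * real n)) = z (2 * n + 1) / 2 / real n"
        by (simp add: u_def)
      ultimately show ?case by (simp only: add_divide_distrib)
    qed
  qed
  then show ?thesis unfolding free_energy_def by (simp add: limI)
qed

text \<open>Self-avoiding walks outnumber positive ones by at most the number of fold lists, so both
  counts grow at the same rate. The sandwich also shows that the limit defining \<open>mu\<close>
  exists.\<close>

lemma mu_eq_exp_free_energy_1: "mu d = exp (free_energy d 1)"
proof -
  have Apos: "0 < A_pos d n 1" for n using A_pos_pos[OF d2, of 1] by simp
  have cpos: "0 < real (c_saw d n)" for n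
    using Apos A_pos_1_le_c_saw by (rule less_le_trans)
  have lim1: "(\<lambda>n. ln (A_pos d n 1) / real n) \<longlonglongrightarrow> free_energy d 1"
    by (rule free_energy_limit) simp
  have "(\<lambda>n. (sqrt (2 * real n) + 1) * ln (real n + 2) / real n) \<longlonglongrightarrow> 0" by real_asymp
  from tendsto_add[OF this lim1]
  have upper: "(\<lambda>n. (sqrt (2 * real n) + 1) * ln (real n + 2) / real n + ln (A_pos d n 1) / real n)
      \<longlonglongrightarrow> free_energy d 1" by simp
  have "(\<lambda>n. ln (real (c_saw d n)) / real n) \<longlonglongrightarrow> free_energy d 1"
  proof (rule tendsto_sandwich[OF _ _ lim1 upper]; intro always_eventually allI)
    fix n
    show "ln (A_pos d n 1) / real n \<le> ln (real (c_saw d n)) / real n"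
      using Apos cpos A_pos_1_le_c_saw by (intro divide_right_mono) auto
    have "ln (real (c_saw d n)) \<le> ln (real (card (fold_seqs n)) * A_pos d n 1)"
      using cpos Apos ln_card_fold_seqs_le(2) c_saw_le_A_pos_1[OF d2]
      by (subst ln_le_cancel_iff) (auto intro!: mult_pos_pos)
    also have "\<dots> = ln (real (card (fold_seqs n))) + ln (A_pos d n 1)"
      using ln_card_fold_seqs_le(2)[of n] Apos[of n] by (simp add: ln_mult)
    finally have "ln (real (c_saw d n)) \<le> (sqrt (2 * real n) + 1) * ln (real n + 2) + ln (A_pos d n 1)"
      using ln_card_fold_seqs_le(1)[of n] by simp
    then show "ln (real (c_saw d n)) / real n
      \<le> (sqrt (2 * real n) + 1) * ln (real n + 2) / real n + ln (A_pos d n 1) / real n"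
      unfolding add_divide_distrib[symmetric] by (intro divide_right_mono) auto
  qed
  then have "(\<lambda>n. exp (ln (real (c_saw d n)) / real n)) \<longlonglongrightarrow> exp (free_energy d 1)"
    by (rule tendsto_exp)
  \<comment> \<open>The identity fails at n = 0, where \<open>root 0\<close> is 0 by
    convention.\<close>
  moreover have "\<forall>\<^sub>F n in sequentially. exp (ln (real (c_saw d n)) / real n) = root n (real (c_saw d n))"
    using eventually_gt_at_top[of 0]
  proof eventually_elim
    case (elim n)
    then show ?case using cpos[of n] by (simp add: root_powr_inverse powr_def field_simps)
  qed
  ultimately have "(\<lambda>n. root n (real (c_saw d n))) \<longlonglongrightarrow> exp (free_energy d 1)"
    by (rule Lim_transform_eventually)
  then show ?thesis unfolding mu_def by (rule limI)
qed

section \<open>Dependence of the free energy on \<open>a\<close>, and the critical point\<close>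

lemma free_energy_mono:
  assumes "0 < a" "a \<le> b"
  shows "free_energy d a \<le> free_energy d b"
proof (rule LIMSEQ_le[OF free_energy_limit free_energy_limit])
  show "\<exists>N. \<forall>n\<ge>N. ln (A_pos d n a) / real n \<le> ln (A_pos d n b) / real n"
    using A_pos_mono[OF assms] A_pos_pos[OF d2] assms by (auto intro!: divide_right_mono)
qed (use assms in auto)

lemma free_energy_le_add_ln:
  assumes "0 < b" "b \<le> a"
  shows "free_energy d a \<le> ln (a / b) + free_energy d b"
proof (rule LIMSEQ_le[OF free_energy_limit tendsto_add[OF tendsto_const free_energy_limit]])
  have "ln (A_pos d n a) / real n \<le> ln (a / b) + ln (A_pos d n b) / real n" if "1 \<le> n" for n
  proof -
    have pos: "0 < A_pos d n a" "0 < A_pos d n b" using A_pos_pos[OF d2] assms by auto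
    have "ln (A_pos d n a) \<le> ln ((a / b) ^ n * A_pos d n b)"
      using A_pos_le_scaled[OF assms, of d n] pos assms by (subst ln_le_cancel_iff) auto
    also have "\<dots> = real n * ln (a / b) + ln (A_pos d n b)"
      using pos assms by (simp add: ln_mult ln_realpow)
    finally have "ln (A_pos d n a) / real n \<le> (real n * ln (a / b) + ln (A_pos d n b)) / real n"
      by (rule divide_right_mono) simp
    then show ?thesis using that by (simp add: add_divide_distrib)
  qed
  then show "\<exists>N. \<forall>n\<ge>N. ln (A_pos d n a) / real n \<le> ln (a / b) + ln (A_pos d n b) / real n" by blast
qed (use assms in auto)

lemma ln_le_free_energy:
  assumes "0 < a"
  shows "ln a \<le> free_energy d a"
proof (rule LIMSEQ_le_const[OF free_energy_limit[OF assms]])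
  have "ln a \<le> ln (A_pos d n a) / real n" if "1 \<le> n" for n
  proof -
    have "ln (a ^ n) \<le> ln (A_pos d n a)"
      using A_pos_ge_power[OF d2 assms] A_pos_pos[OF d2 assms] assms by (subst ln_le_cancel_iff) auto
    then show ?thesis using that assms by (simp add: ln_realpow field_simps)
  qed
  then show "\<exists>N. \<forall>n\<ge>N. ln a \<le> ln (A_pos d n a) / real n" by blast
qed

text \<open>Monotonicity gives this only for \<open>a \<ge> 1\<close>; the lifted walks, one step
  longer, cover repulsive weights as well.\<close>

lemma free_energy_ge_free_energy_1:
  assumes "0 < a"
  shows "free_energy d 1 \<le> free_energy d a"
proof (rule LIMSEQ_le[OF _ LIMSEQ_Suc[OF free_energy_limit[OF assms]]])
  have "(\<lambda>n. ln (A_pos d n 1) / real n * (real n / real (Suc n))) \<longlonglongrightarrow> free_energy d 1 * 1"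
    by (intro tendsto_mult free_energy_limit) (simp, real_asymp)
  then show "(\<lambda>n. ln (A_pos d n 1) / real n * (real n / real (Suc n))) \<longlonglongrightarrow> free_energy d 1" by simp
  have "ln (A_pos d n 1) / real n * (real n / real (Suc n)) \<le> ln (A_pos d (Suc n) a) / real (Suc n)"
    if "1 \<le> n" for n
  proof -
    have "ln (A_pos d n 1) \<le> ln (A_pos d (Suc n) a)"
      using A_pos_Suc_ge[OF d2 assms] A_pos_pos[OF d2] assms by (subst ln_le_cancel_iff) auto
    then show ?thesis using that by (simp add: divide_right_mono)
  qed
  then show "\<exists>N. \<forall>n\<ge>N. ln (A_pos d n 1) / real n * (real n / real (Suc n))
      \<le> ln (A_pos d (Suc n) a) / real (Suc n)" by blast
qed

text \<open>The point is \<open>a \<le> a_crit d\<close>, where \<open>free_energy d a\<close> must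
  be shown to equal its value at 1 even if the supremum is not known to be attained. An
  approximating \<open>b\<close> from the set suffices up to an error
  \<open>ln (a / b)\<close>.\<close>

lemma lambda_a_eq_exp_free_energy:
  assumes a: "0 < a"
  shows "lambda_a d a = exp (free_energy d a)"
proof (cases "a \<le> a_crit d")
  case True
  define S where "S = {a. 0 < a \<and> free_energy d a = free_energy d 1}"
  have crit: "a_crit d = Sup S" by (simp add: a_crit_def S_def mu_eq_exp_free_energy_1)
  have ne: "S \<noteq> {}" by (auto simp: S_def intro: exI[of _ 1])
  \<comment> \<open>Without a bound \<open>Sup S\<close> would be an unspecified real; the straight
    walk along the wall supplies it through ln b \<le> F(b).\<close>
  have bdd: "bdd_above S"
  proof (rule bdd_aboveI)
    fix b assume "b \<in> S"
    then have "ln b \<le> free_energy d 1" "0 < b" using ln_le_free_energy[of b] by (auto simp: S_def)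
    then show "b \<le> exp (free_energy d 1)" by (metis exp_le_cancel_iff exp_ln)
  qed
  have "free_energy d a \<le> free_energy d 1"
  proof (rule field_le_epsilon)
    fix \<epsilon> :: real assume \<epsilon>: "\<epsilon> > 0"
    \<comment> \<open>The factor is chosen so that \<open>ln (a / b)\<close> is at most
      \<open>\<epsilon>\<close>.\<close>
    have "a * exp (- \<epsilon>) < a" using a \<epsilon> by simp
    also have "\<dots> \<le> Sup S" using True crit by simp
    finally obtain b where b: "b \<in> S" "a * exp (- \<epsilon>) < b"
      using less_cSup_iff[OF ne bdd] by blast
    then have b0: "0 < b" "free_energy d b = free_energy d 1" by (auto simp: S_def)
    show "free_energy d a \<le> free_energy d 1 + \<epsilon>"
    proof (cases "a \<le> b")
      case True
      with free_energy_mono[OF a True] b0 \<epsilon> show ?thesis by simp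
    next
      case False
      have "ln (a * exp (- \<epsilon>)) \<le> ln b" using b a b0 by (subst ln_le_cancel_iff) auto
      then have "ln (a / b) \<le> \<epsilon>" using a b0 by (simp add: ln_mult ln_div)
      with free_energy_le_add_ln[of b a] False b0 show ?thesis by simp
    qed
  qed
  with free_energy_ge_free_energy_1[OF a] True show ?thesis
    by (simp add: lambda_a_def mu_eq_exp_free_energy_1)
qed (simp add: lambda_a_def)

end

theorem theorem2p2:
  fixes d :: nat and a :: real
  assumes "d \<ge> 2" and "a > 0"
  shows "\<forall>\<rho>. 0 < \<rho> \<and> \<rho> < 1 \<longrightarrow> (\<forall>\<epsilon>>0. \<exists>N0. \<forall>N\<ge>N0. N \<ge> 1 \<longrightarrow>
           \<bar>1 - real (nu d N a \<rho>) / real N\<bar> < \<epsilon>)"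
proof (intro allI impI)
  fix \<rho> \<epsilon> :: real assume \<rho>: "0 < \<rho> \<and> \<rho> < 1" and \<epsilon>: "\<epsilon> > 0"
  define c where "c n = A_pos d n a / lambda_a d a ^ n" for n
  have lam: "lambda_a d a = exp (free_energy d a)"
    by (rule lambda_a_eq_exp_free_energy[OF assms])
  have A: "0 < A_pos d n a" for n by (rule A_pos_pos[OF assms])
  then have pos: "0 < c n" for n by (simp add: c_def lam)
  have "(\<lambda>n. ln (A_pos d n a) / real n - free_energy d a) \<longlonglongrightarrow> free_energy d a - free_energy d a"
    by (rule tendsto_diff[OF free_energy_limit[OF assms] tendsto_const])
  then have "(\<lambda>n. ln (A_pos d n a) / real n - free_energy d a) \<longlonglongrightarrow> 0" by simp
  \<comment> \<open>At n = 0 both quotients are 0 by convention, so the two sides may differ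
    there.\<close>
  moreover have "\<forall>\<^sub>F n in sequentially. ln (A_pos d n a) / real n - free_energy d a = ln (c n) / real n"
    using eventually_gt_at_top[of 0]
  proof eventually_elim
    case (elim n)
    have "ln (c n) = ln (A_pos d n a) - real n * free_energy d a"
      using A[of n] by (simp add: c_def lam ln_div flip: exp_of_nat_mult)
    with elim show ?case by (simp add: diff_divide_distrib)
  qed
  ultimately have lim: "(\<lambda>n. ln (c n) / real n) \<longlonglongrightarrow> 0"
    by (rule Lim_transform_eventually)
  have g: "g_poly d N a = (\<Sum>n\<le>N. monom (complex_of_real (c n)) n)" for N
    by (simp add: g_poly_def c_def)
  \<comment> \<open>The constant coefficient \<open>c 0\<close> is positive; this makes the sum of
    orders in \<open>nu\<close> the size of a genuine root multiset.\<close>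
  have "g_poly d N a \<noteq> 0" for N
  proof
    assume "g_poly d N a = 0"
    then have "poly (g_poly d N a) 0 = 0" by simp
    moreover have "poly (g_poly d N a) 0 = complex_of_real (c 0)"
      unfolding g poly_0_coeff_0 by (simp add: coeff_sum)
    ultimately show False using pos[of 0] by simp
  qed
  from nu_eq_size_proots[OF this]
  have nu: "nu d N a \<rho> = size {#z \<in># proots (\<Sum>n\<le>N. monom (complex_of_real (c n)) n).
      1 - \<rho> \<le> cmod z \<and> cmod z \<le> 1 / (1 - \<rho>)#}" for N
    by (simp only: g)
  have \<rho>': "0 < 1 - \<rho>" "1 - \<rho> < 1" using \<rho> by auto
  from zeros_near_unit_circle[where c = c and r = "1 - \<rho>" and \<epsilon> = \<epsilon>, OF pos lim \<rho>' \<epsilon>]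
  have "\<forall>\<^sub>F N in sequentially. \<bar>1 - real (nu d N a \<rho>) / real N\<bar> < \<epsilon>"
    by (simp only: nu)
  then show "\<exists>N0. \<forall>N\<ge>N0. N \<ge> 1 \<longrightarrow> \<bar>1 - real (nu d N a \<rho>) / real N\<bar> < \<epsilon>"
    unfolding eventually_sequentially by blast
qed

end
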